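(* Let $(\lambda,\mu)\in{\sf Kostka}_r^{\mathbb Z}$. The underlying undirected graph of the KGR graph $G(\lambda,\mu)$ is a forest, and it is planar with respect to the embedding in which each vertex is placed at its matrix position and each arc is drawn as a straight segment (no two arcs cross). Consequently any conservative subtree of $G(\lambda,\mu)$ is a tree. Moreover, if $G(\lambda,\mu)$ has a conservative subtree, then $(\lambda,\mu)$ is not in the Hilbert basis of ${\sf Kostka}_r^{\mathbb Z}$.
   Context: Fix $r\ge1$. ${\sf Kostka}_r^{\mathbb Z}$ is the semigroup (componentwise addition) of pairs $(\lambda,\mu)$ of partitions with at most $r$ nonzero parts, $|\lambda|=|\mu|$, $\sum_{i\le t}\lambda_i\ge\sum_{i\le t}\mu_i$ for all $t$; its Hilbert basis is the set of nonzero elements not expressible as a sum of two nonzero elements. $\lambda'$ is the conjugate partition. Canonical (Ryser) matrix $A(\lambda,\mu)$: let $s=\lambda_1$. Start with the $r\times s$ $\{0,1\}$-matrix whose row $i$ has $\mu_i$ ones in columns $1,\ldots,\mu_i$. For $j=s,s-1,\ldots,1$ in turn: looking only at columns $1,\ldots,j$ of the current matrix, choose $\lambda'_j$ rows, taking rows with the largest number of $1$'s in columns $1,\ldots,j$ and breaking ties by preferring rows further south (larger row index); in each chosen row, move the rightmost $1$ among columns $1,\ldots,j$ to column $j$. Columns $j,\ldots,s$ are not changed afterwards. The final matrix is $A(\lambda,\mu)$ (row sums $\mu_i$, column sums $\lambda'_j$). Define $A^*(\lambda,\mu)_{i,j}=A(\lambda,\mu)_{i,j}-A(\lambda,\mu)_{i+1,j}$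 (with row $r+1$ taken to be $0$); its entries lie in $\{-1,0,1\}$. KGR graph $G(\lambda,\mu)$: a directed graph whose vertices are the positions of the nonzero entries of $A^*(\lambda,\mu)$, with arcs: (I) (horizontal) from each $-1$ entry to the rightmost $1$ entry strictly to its left in the same row; (II) (vertical) from each $1$ entry to the $-1$ entry in the same column, if one exists. A source of a directed graph is a vertex with no incoming arcs, a sink a vertex with no outgoing arcs; connectivity refers to the underlying undirected graph. A \emph{conservative subtree} of $G(\lambda,\mu)$ is a connected nontrivial subgraph $G'$ such that whenever a vertical arc appears in $G'$, all vertical arcs of $G(\lambda,\mu)$ in the same column appear in $G'$, and one of the following holds: (C.1) $G'$ is a connected component of $G(\lambda,\mu)$; (C.2) $G'$ has a unique sink, it is a $-1$ entry of $A^*(\lambda,\mu)$, one source of $G'$ is a $1$ entry in the same row as this sink, and all other sources of $G'$ are sources of $G(\lambda,\mu)$. *)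

theory Defs
  imports
    "HOL-Analysis.Analysis"
    "HOL-Library.Function_Algebras"
    "HOL-Library.Product_Plus"
    "Graph_Theory.Digraph_Component"
begin

text \<open>
  Parts, rows and columns are indexed from 0: the part usually written \<open>\<lambda>\<^sub>i\<close> is \<open>l (i - 1)\<close>, and
  entry \<open>(i, j)\<close> of a matrix is \<open>M (i - 1) (j - 1)\<close>.
\<close>

section \<open>The Kostka semigroup\<close>

definition partition_le :: "nat \<Rightarrow> (nat \<Rightarrow> nat) \<Rightarrow> bool" where
  "partition_le r l \<longleftrightarrow> antimono l \<and> (\<forall>i\<ge>r. l i = 0)"

definition conjugate :: "(nat \<Rightarrow> nat) \<Rightarrow> nat \<Rightarrow> nat" where
  "conjugate l j = card {i. j < l i}"

definition Kostka :: "nat \<Rightarrow> ((nat \<Rightarrow> nat) \<times> (nat \<Rightarrow> nat)) set" where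
  "Kostka r = {(l, m). partition_le r l \<and> partition_le r m \<and>
     (\<Sum>i<r. l i) = (\<Sum>i<r. m i) \<and> (\<forall>t. (\<Sum>i<t. m i) \<le> (\<Sum>i<t. l i))}"

definition hilbert_basis :: "'a::monoid_add set \<Rightarrow> 'a set" where
  "hilbert_basis S = {x \<in> S. x \<noteq> 0 \<and> \<not> (\<exists>y\<in>S. \<exists>z\<in>S. y \<noteq> 0 \<and> z \<noteq> 0 \<and> x = y + z)}"

section \<open>The canonical matrix\<close>

definition ones_upto :: "(nat \<Rightarrow> nat \<Rightarrow> int) \<Rightarrow> nat \<Rightarrow> nat \<Rightarrow> nat" where
  "ones_upto M j i = card {c. c \<le> j \<and> M i c = 1}"

definition preferred :: "(nat \<Rightarrow> nat \<Rightarrow> int) \<Rightarrow> nat \<Rightarrow> nat \<Rightarrow> nat \<Rightarrow> bool" where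
  "preferred M j i i' \<longleftrightarrow>
     ones_upto M j i > ones_upto M j i' \<or> (ones_upto M j i = ones_upto M j i' \<and> i > i')"

text \<open>The first \<open>k\<close> of the rows \<open>0, \<dots>, r - 1\<close> in the strict linear order \<^const>\<open>preferred\<close>.\<close>

definition chosen_rows :: "nat \<Rightarrow> nat \<Rightarrow> (nat \<Rightarrow> nat \<Rightarrow> int) \<Rightarrow> nat \<Rightarrow> nat set" where
  "chosen_rows r k M j = {i. i < r \<and> card {i'. i' < r \<and> preferred M j i' i} < k}"

text \<open>
  A row without a 1 in columns \<open>0, \<dots>, j\<close> is left alone; for pairs in \<^const>\<open>Kostka\<close> no such row
  is ever chosen.
\<close>

definition move_one :: "nat \<Rightarrow> (nat \<Rightarrow> int) \<Rightarrow> nat \<Rightarrow> int" where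
  "move_one j R =
     (if \<exists>c\<le>j. R c = 1 then (R(Max {c. c \<le> j \<and> R c = 1} := 0))(j := 1) else R)"

definition ryser_step ::
    "nat \<Rightarrow> (nat \<Rightarrow> nat) \<Rightarrow> nat \<Rightarrow> (nat \<Rightarrow> nat \<Rightarrow> int) \<Rightarrow> nat \<Rightarrow> nat \<Rightarrow> int" where
  "ryser_step r l j M =
     (\<lambda>i. if i \<in> chosen_rows r (conjugate l j) M j then move_one j (M i) else M i)"

definition initial_matrix :: "nat \<Rightarrow> (nat \<Rightarrow> nat) \<Rightarrow> nat \<Rightarrow> nat \<Rightarrow> int" where
  "initial_matrix r m i j = (if i < r \<and> j < m i then 1 else 0)"

definition canonical_matrix :: "nat \<Rightarrow> (nat \<Rightarrow> nat) \<Rightarrow> (nat \<Rightarrow> nat) \<Rightarrow> nat \<Rightarrow> nat \<Rightarrow> int" where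
  "canonical_matrix r l m = fold (ryser_step r l) (rev [0..<l 0]) (initial_matrix r m)"

text \<open>Row \<open>r\<close> of the canonical matrix is zero, so the last row needs no separate case.\<close>

definition star_matrix :: "nat \<Rightarrow> (nat \<Rightarrow> nat) \<Rightarrow> (nat \<Rightarrow> nat) \<Rightarrow> nat \<Rightarrow> nat \<Rightarrow> int" where
  "star_matrix r l m i j = canonical_matrix r l m i j - canonical_matrix r l m (Suc i) j"

section \<open>The KGR graph\<close>

definition kgr_verts :: "nat \<Rightarrow> (nat \<Rightarrow> nat) \<Rightarrow> (nat \<Rightarrow> nat) \<Rightarrow> (nat \<times> nat) set" where
  "kgr_verts r l m = {(i, j). i < r \<and> j < l 0 \<and> star_matrix r l m i j \<noteq> 0}"

definition kgr_horizontal :: "nat \<Rightarrow> (nat \<Rightarrow> nat) \<Rightarrow> (nat \<Rightarrow> nat) \<Rightarrow> (nat \<times> nat) rel" where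
  "kgr_horizontal r l m =
     {((i, j), (i, k)) | i j k.
        (i, j) \<in> kgr_verts r l m \<and> (i, k) \<in> kgr_verts r l m \<and>
        star_matrix r l m i j = -1 \<and> star_matrix r l m i k = 1 \<and> k < j \<and>
        (\<forall>c. k < c \<and> c < j \<longrightarrow> star_matrix r l m i c \<noteq> 1)}"

definition kgr_vertical :: "nat \<Rightarrow> (nat \<Rightarrow> nat) \<Rightarrow> (nat \<Rightarrow> nat) \<Rightarrow> (nat \<times> nat) rel" where
  "kgr_vertical r l m =
     {((i, j), (k, j)) | i j k.
        (i, j) \<in> kgr_verts r l m \<and> (k, j) \<in> kgr_verts r l m \<and>
        star_matrix r l m i j = 1 \<and> star_matrix r l m k j = -1}"

definition kgr_graph :: "nat \<Rightarrow> (nat \<Rightarrow> nat) \<Rightarrow> (nat \<Rightarrow> nat) \<Rightarrow> (nat \<times> nat) pair_pre_digraph" where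
  "kgr_graph r l m =
     \<lparr> pverts = kgr_verts r l m, parcs = kgr_horizontal r l m \<union> kgr_vertical r l m \<rparr>"

section \<open>Graph notions\<close>

definition graph_sources :: "'a pair_pre_digraph \<Rightarrow> 'a set" where
  "graph_sources G = {v \<in> pverts G. in_arcs (with_proj G) v = {}}"

definition graph_sinks :: "'a pair_pre_digraph \<Rightarrow> 'a set" where
  "graph_sinks G = {v \<in> pverts G. out_arcs (with_proj G) v = {}}"

text \<open>
  The library's \<^const>\<open>Digraph_Component.forest\<close> and \<^const>\<open>Digraph_Component.tree\<close> only forbid
  directed cycles. Here cycles of the underlying undirected graph are forbidden. In its symmetric
  digraph, the closed walks that are a \<open>cycle\<close> of length 2 just run along one edge
  and back, so they do not count.
\<close>

definition undirected_forest :: "'a pair_pre_digraph \<Rightarrow> bool" where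
  "undirected_forest G \<longleftrightarrow>
     \<not> (\<exists>p. pre_digraph.cycle (with_proj (mk_symmetric (with_proj G))) p \<and> length p \<noteq> 2)"

definition undirected_tree :: "'a pair_pre_digraph \<Rightarrow> bool" where
  "undirected_tree G \<longleftrightarrow> Digraph_Component.connected (with_proj G) \<and> undirected_forest G"

definition connected_component_of :: "'a pair_pre_digraph \<Rightarrow> 'a pair_pre_digraph \<Rightarrow> bool" where
  "connected_component_of H G \<longleftrightarrow>
     pre_digraph.max_subgraph (with_proj G) Digraph_Component.connected (with_proj H)"

definition straight_line_plane :: "('a \<Rightarrow> real \<times> real) \<Rightarrow> 'a pair_pre_digraph \<Rightarrow> bool" where
  "straight_line_plane pos G \<longleftrightarrow>
     inj_on pos (pverts G) \<and>
     (\<forall>(u, v)\<in>parcs G. \<forall>w\<in>pverts G.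
        pos w \<in> closed_segment (pos u) (pos v) \<longrightarrow> w \<in> {u, v}) \<and>
     (\<forall>(u, v)\<in>parcs G. \<forall>(x, y)\<in>parcs G. (u, v) \<noteq> (x, y) \<longrightarrow>
        closed_segment (pos u) (pos v) \<inter> closed_segment (pos x) (pos y)
          \<subseteq> pos ` ({u, v} \<inter> {x, y}))"

text \<open>Columns run to the right and rows run downwards.\<close>

definition matrix_position :: "nat \<times> nat \<Rightarrow> real \<times> real" where
  "matrix_position = (\<lambda>(i, j). (real j, - real i))"

section \<open>Conservative subtrees\<close>

text \<open>
  A subgraph is nontrivial if it is neither empty nor the whole graph; a single vertex is allowed.
  The whole graph has to be excluded: for \<open>r = 2\<close>, \<open>\<lambda> = (2)\<close> and \<open>\<mu> = (1, 1)\<close> the KGR graph is a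
  path on three vertices, hence a component of itself, but the pair is in the Hilbert basis.
\<close>

definition conservative_subtree ::
    "nat \<Rightarrow> (nat \<Rightarrow> nat) \<Rightarrow> (nat \<Rightarrow> nat) \<Rightarrow> (nat \<times> nat) pair_pre_digraph \<Rightarrow> bool" where
  "conservative_subtree r l m H \<longleftrightarrow>
     subgraph (with_proj H) (with_proj (kgr_graph r l m)) \<and>
     Digraph_Component.connected (with_proj H) \<and>
     pverts H \<noteq> {} \<and> H \<noteq> kgr_graph r l m \<and>
     (\<forall>i j k i' k'. ((i, j), (k, j)) \<in> parcs H \<inter> kgr_vertical r l m \<and>
        ((i', j), (k', j)) \<in> kgr_vertical r l m \<longrightarrow> ((i', j), (k', j)) \<in> parcs H) \<and>
     (connected_component_of H (kgr_graph r l m) \<or>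
      (\<exists>i j k. graph_sinks H = {(i, j)} \<and> star_matrix r l m i j = -1 \<and>
         (i, k) \<in> graph_sources H \<and> star_matrix r l m i k = 1 \<and>
         graph_sources H - {(i, k)} \<subseteq> graph_sources (kgr_graph r l m)))"

end

theory Submission
  imports Defs
begin

text \<open>
  Before column \<open>j\<close> is processed, every row of the matrix is left-justified in the columns up to
  \<open>j\<close>, and its row lengths form a partition. A -1 of the star matrix in row \<open>i\<close>
  and column \<open>j\<close> means that the rows \<open>i\<close> and \<open>i + 1\<close> were tied and the tie was broken to the
  south. Hence a column has at most one -1, and in every row each -1 is directly preceded by its
  own 1. So every vertex of the KGR graph has at most one outgoing arc, and along arcs the
  column never increases: the graph is a forest. It is plane since rows crossed by a vertical
  arc are tied, whereas rows along a horizontal arc are not.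

  The columns met by a conservative subtree split the canonical matrix into two matrices. Pairing
  each -1 with a 1 of its row shows that both have weakly decreasing row sums, so by the Gale-Ryser
  inequalities they decompose the pair in the Kostka semigroup.
\<close>

section \<open>Correctness of Ryser's construction\<close>

text \<open>The number of predecessors is strictly monotone along the order, hence injective on
  \<open>S\<close>, and stays below \<open>card S\<close>. So it takes each value below
  \<open>card S\<close> exactly once.\<close>

lemma card_first_elements:
  fixes R :: "'a \<Rightarrow> 'a \<Rightarrow> bool"
  assumes fin: "finite S"
    and irrefl: "\<And>x. \<not> R x x"
    and trans: "\<And>x y z. R x y \<Longrightarrow> R y z \<Longrightarrow> R x z"
    and total: "\<And>x y. x \<in> S \<Longrightarrow> y \<in> S \<Longrightarrow> x \<noteq> y \<Longrightarrow> R x y \<or> R y x"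
    and le: "k \<le> card S"
  shows "card {x \<in> S. card {y \<in> S. R y x} < k} = k"
proof -
  define rank where "rank x = card {y \<in> S. R y x}" for x
  have mono: "rank x < rank y" if "x \<in> S" "R x y" for x y
    unfolding rank_def
  proof (rule psubset_card_mono)
    show "{z \<in> S. R z x} \<subset> {z \<in> S. R z y}"
      using that irrefl trans by blast
  qed (use fin in simp)
  have inj: "inj_on rank S"
    by (rule inj_onI) (metis mono total less_irrefl)
  have lt: "rank x < card S" if "x \<in> S" for x
    unfolding rank_def
    by (rule psubset_card_mono) (use fin that irrefl in auto)
  have "rank ` S = {..<card S}"
    by (rule card_subset_eq) (use lt inj in \<open>auto simp: card_image\<close>)
  then have "rank ` {x \<in> S. rank x < k} = {..<k}"
    using le by (auto simp: set_eq_iff image_iff) (metis imageE lessThan_iff less_le_trans)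
  moreover have "card (rank ` {x \<in> S. rank x < k}) = card {x \<in> S. rank x < k}"
    by (rule card_image) (use inj in \<open>auto simp: inj_on_def\<close>)
  ultimately show ?thesis
    by (simp add: rank_def)
qed

section \<open>Conjugate partitions and their columns\<close>

lemma less_conjugate_iff:
  assumes "partition_le r l"
  shows "i < conjugate l c \<longleftrightarrow> c < l i"
proof -
  let ?D = "{i. c < l i}"
  have anti: "antimono l" and zero: "\<And>i. i \<ge> r \<Longrightarrow> l i = 0"
    using assms by (auto simp: partition_le_def)
  have fin: "finite ?D"
    by (rule finite_subset[of _ "{..<r}"]) (use zero in \<open>fastforce simp: not_less[symmetric]\<close>)+
  \<comment> \<open>Since \<open>l\<close> is antitone, \<open>?D\<close> is an initial segment of
    the rows, so its cardinality alone decides membership.\<close>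
  show ?thesis
  proof
    assume "c < l i"
    then have "{..i} \<subseteq> ?D"
      using anti by (auto dest: antimonoD[of l _ i] intro: less_le_trans)
    from card_mono[OF fin this] show "i < conjugate l c"
      by (simp add: conjugate_def)
  next
    assume less: "i < conjugate l c"
    show "c < l i"
    proof (rule ccontr)
      assume "\<not> c < l i"
      then have "?D \<subseteq> {..<i}"
        using anti by (auto intro!: leI dest: antimonoD[of l i] less_le_trans)
      from card_mono[OF _ this] less show False
        by (simp add: conjugate_def)
    qed
  qed
qed

lemma conjugate_le:
  assumes "partition_le r l"
  shows "conjugate l c \<le> r"
  using less_conjugate_iff[OF assms, of r c] assms by (auto simp: partition_le_def)

lemma antimono_conjugate:
  assumes "partition_le r l"
  shows "antimono (conjugate l)"
  by (rule antimonoI)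
    (metis assms le_less_trans less_conjugate_iff less_irrefl not_le)

text \<open>Double counting of the cells in the first \<open>t\<close> rows and the columns of
  \<open>J\<close> of the diagram of \<open>l\<close>.\<close>

lemma sum_min_conjugate:
  assumes "partition_le r l" "finite J"
  shows "(\<Sum>c\<in>J. min t (conjugate l c)) = (\<Sum>i<t. card {c \<in> J. c < l i})"
proof -
  have "min t (conjugate l c) = (\<Sum>i<t. of_bool (c < l i))" for c
  proof -
    have "(\<Sum>i<t. of_bool (c < l i)) = card ({..<t} \<inter> {i. c < l i})"
      by simp
    also have "{..<t} \<inter> {i. c < l i} = {..<min t (conjugate l c)}"
      using less_conjugate_iff[OF assms(1)] by auto
    finally show ?thesis
      by simp
  qed
  then have "(\<Sum>c\<in>J. min t (conjugate l c)) = (\<Sum>i<t. \<Sum>c\<in>J. of_bool (c < l i))"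
    by (simp add: sum.swap[of _ J])
  also have "\<dots> = (\<Sum>i<t. card {c \<in> J. c < l i})"
    using assms(2) by (auto intro!: sum.cong arg_cong[of _ _ card])
  finally show ?thesis .
qed

text \<open>
  \<open>k\<close> is dominated by the partition whose diagram has the columns \<open>p 0, \<dots>, p (j - 1)\<close>.
\<close>

definition fits_columns :: "nat \<Rightarrow> (nat \<Rightarrow> nat) \<Rightarrow> nat \<Rightarrow> (nat \<Rightarrow> nat) \<Rightarrow> bool" where
  "fits_columns r p j k \<longleftrightarrow> partition_le r k \<and> (\<Sum>i<r. k i) = (\<Sum>c<j. p c) \<and>
     (\<forall>t. (\<Sum>i<t. k i) \<le> (\<Sum>c<j. min t (p c)))"

lemma fits_columns_bound:
  assumes "fits_columns r p j k"
  shows "k i \<le> j"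
proof -
  have "k 0 \<le> (\<Sum>c<j. min 1 (p c))"
    using assms by (auto simp: fits_columns_def dest!: spec[of _ 1])
  also have "\<dots> \<le> (\<Sum>c<j. 1)"
    by (rule sum_mono) simp
  finally have "k 0 \<le> j"
    by simp
  moreover have "k i \<le> k 0"
    using assms by (auto simp: fits_columns_def partition_le_def antimono_def)
  ultimately show ?thesis
    by simp
qed

text \<open>
  A last column of height \<open>p j\<close> is taken off the \<open>p j\<close> longest rows. If a partial sum of the
  new row lengths were too large, then so would be all later ones up to the last chosen row: the
  column heights bound concave increments, and the rows in between are tied.
\<close>

lemma fits_columns_step:
  assumes fits: "fits_columns r p (Suc j) k"
    and p: "antimono p"
    and C: "C \<subseteq> {..<r}" "card C = p j"
    and first: "\<And>u s. s \<in> C \<Longrightarrow> u < r \<Longrightarrow> k s < k u \<or> k s = k u \<and> s < u \<Longrightarrow> u \<in> C"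
  shows "\<And>i. i \<in> C \<Longrightarrow> 0 < k i"
    and "\<And>i. k i = Suc j \<Longrightarrow> i \<in> C"
    and "fits_columns r p j (\<lambda>i. k i - of_bool (i \<in> C))"
proof -
  have anti: "\<And>u s. u \<le> s \<Longrightarrow> k s \<le> k u" and zero: "\<And>i. i \<ge> r \<Longrightarrow> k i = 0"
    and supp: "\<And>i. 0 < k i \<Longrightarrow> i < r"
    and tot: "(\<Sum>i<r. k i) = (\<Sum>c<Suc j. p c)"
    and dom: "\<And>t. (\<Sum>i<t. k i) \<le> (\<Sum>c<Suc j. min t (p c))"
    using fits by (auto simp: fits_columns_def partition_le_def antimono_def intro: leI ccontr)
  have finC: "finite C"
    using C(1) finite_subset by blast
  have pj: "p j \<le> p c" if "c \<le> j" for c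
    using p that by (auto simp: antimono_def)
  show pos: "0 < k i" if i: "i \<in> C" for i
  proof (rule ccontr)
    assume "\<not> 0 < k i"
    then have ki: "k i = 0"
      by simp
    \<comment> \<open>A chosen empty row would force all nonempty rows to be chosen as well, so
      there are \<open>n < p j\<close> of them. They hold all cells, but column \<open>j\<close>
      does not fit into \<open>n\<close> rows, contradicting dominance at
      \<open>t = n\<close>.\<close>
    define n where "n = card {u. 0 < k u}"
    have sub: "{u. 0 < k u} \<subseteq> C - {i}"
      using first[OF i] supp ki by auto
    have "n \<le> card (C - {i})"
      unfolding n_def by (rule card_mono) (use finC sub in auto)
    also have "\<dots> < p j"
      using i finC C(2) by (metis card_Diff1_less)
    finally have n: "n < p j" .
    have n_iff: "u < n \<longleftrightarrow> 0 < k u" for u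
      using less_conjugate_iff[of r k u 0] fits by (simp add: fits_columns_def conjugate_def n_def)
    have "n \<le> r"
      using n_iff[of r] supp[of r] by linarith
    moreover have "k i = 0" if "n \<le> i" for i
      using n_iff[of i] that by simp
    ultimately have "(\<Sum>c<Suc j. p c) = (\<Sum>i<n. k i)"
      unfolding tot[symmetric] by (intro sum.mono_neutral_right) auto
    also have "\<dots> \<le> (\<Sum>c<Suc j. min n (p c))"
      by (rule dom)
    also have "\<dots> < (\<Sum>c<Suc j. p c)"
      by (rule sum_strict_mono_ex1) (use n in \<open>auto intro!: bexI[of _ j]\<close>)
    finally show False
      by simp
  qed
  show full: "i \<in> C" if i: "k i = Suc j" for i
  proof (rule ccontr)
    assume iC: "i \<notin> C"
    have ir: "i < r"
      using i zero by (metis Zero_not_Suc not_le)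
    \<comment> \<open>The full rows are the first \<open>n\<close> ones. If one of them is not
      chosen, then only full rows are chosen, so \<open>p j < n\<close>, and these
      \<open>n * Suc j\<close> cells violate dominance at \<open>t = n\<close>.\<close>
    define n where "n = conjugate k j"
    have part: "partition_le r k"
      using fits by (simp add: fits_columns_def)
    have n_iff: "u < n \<longleftrightarrow> k u = Suc j" for u
      using less_conjugate_iff[OF part, of u j] fits_columns_bound[OF fits, of u]
      by (auto simp: n_def)
    have sub: "insert i C \<subseteq> {..<n}"
    proof -
      have "k s = Suc j" if "s \<in> C" for s
        using first[OF that ir] iC i fits_columns_bound[OF fits, of s] by fastforce
      then show ?thesis
        using n_iff i by auto
    qed
    have "p j < n"
      using card_mono[OF _ sub] iC finC C(2) by simp
    have "n * Suc j = (\<Sum>i<n. k i)"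
      using n_iff by simp
    also have "\<dots> \<le> (\<Sum>c<Suc j. min n (p c))"
      by (rule dom)
    also have "\<dots> < (\<Sum>c<Suc j. n)"
      by (rule sum_strict_mono_ex1) (use \<open>p j < n\<close> in \<open>auto intro!: bexI[of _ j]\<close>)
    finally show False
      by simp
  qed
  let ?k = "\<lambda>i. k i - of_bool (i \<in> C)"
  define chosen_below where "chosen_below t = card (C \<inter> {..<t})" for t
  have k_split: "(\<Sum>i<t. ?k i) + chosen_below t = (\<Sum>i<t. k i)" for t
  proof -
    have "chosen_below t = (\<Sum>i<t. of_bool (i \<in> C))"
      by (simp add: chosen_below_def Int_commute)
    then have "(\<Sum>i<t. ?k i) + chosen_below t = (\<Sum>i<t. ?k i + of_bool (i \<in> C))"
      by (simp add: sum.distrib)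
    also have "\<dots> = (\<Sum>i<t. k i)"
      by (rule sum.cong) (use pos in \<open>auto simp: of_bool_def Suc_leI\<close>)
    finally show ?thesis .
  qed
  have kj: "?k i \<le> j" for i
    using fits_columns_bound[OF fits, of i] full[of i] by (cases "k i = Suc j") auto
  show "fits_columns r p j ?k"
    unfolding fits_columns_def
  proof (intro conjI allI)
    show "partition_le r ?k"
      unfolding partition_le_def
    proof (intro conjI allI impI antimonoI)
      fix u s :: nat assume "u \<le> s"
      show "?k s \<le> ?k u"
      proof (cases "s < r \<and> u \<in> C \<and> s \<notin> C")
        case True
        then have "k s \<noteq> k u"
          using first[of u s] \<open>u \<le> s\<close> by (cases "u = s") auto
        then show ?thesis
          using anti[OF \<open>u \<le> s\<close>] True by simp
      next
        case False
        then show ?thesis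
          using anti[OF \<open>u \<le> s\<close>] zero[of s] by (auto simp: of_bool_def)
      qed
    qed (use zero in auto)
    have "chosen_below r = p j"
      using C by (simp add: chosen_below_def Int_absorb2)
    then show "(\<Sum>i<r. ?k i) = (\<Sum>c<j. p c)"
      using k_split[of r] tot by simp
    fix t
    let ?G = "\<lambda>t. \<Sum>c<j. min t (p c)"
    define g where "g t = card {c. c < j \<and> t < p c}" for t
    have G_Suc: "?G (Suc t) = ?G t + g t" for t
    proof -
      have "?G (Suc t) = (\<Sum>c<j. min t (p c) + of_bool (t < p c))"
        by (rule sum.cong) auto
      also have "\<dots> = ?G t + g t"
        by (simp add: sum.distrib g_def lessThan_def Collect_conj_eq)
      finally show ?thesis .
    qed
    have g_anti: "g s \<le> g u" if "u \<le> s" for u s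
      unfolding g_def by (rule card_mono) (use that in auto)
    show "(\<Sum>i<t. ?k i) \<le> ?G t"
    proof (induction t)
      case 0
      show ?case by simp
    next
      case (Suc t)
      show ?case
      proof (rule ccontr)
        assume "\<not> ?thesis"
        then have gt: "?G (Suc t) < (\<Sum>i<Suc t. ?k i)"
          by simp
        have g_less: "g t < ?k t"
          using gt Suc.IH G_Suc[of t] by simp
        \<comment> \<open>Otherwise every column has height at least \<open>Suc t\<close>, and
          \<open>?G (Suc t)\<close> counts a full rectangle with \<open>j\<close> columns, which
          rows of length at most \<open>j\<close> cannot exceed.\<close>
        have t: "p j < Suc t"
        proof (rule ccontr)
          assume "\<not> p j < Suc t"
          then have "min (Suc t) (p c) = Suc t" if "c < j" for c
            using pj[of c] that by simp
          then have "?G (Suc t) = (\<Sum>c<j. Suc t)"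
            by simp
          moreover have "(\<Sum>i<Suc t. ?k i) \<le> (\<Sum>i<Suc t. j)"
            by (rule sum_mono) (use kj in blast)
          ultimately show False
            unfolding sum_constant card_lessThan of_nat_id using gt by (metis mult.commute not_less)
        qed
        \<comment> \<open>From \<open>p j\<close> on, the removed column contributes its full
          height. So the excess means that some chosen row comes after the first
          \<open>Suc t\<close> rows.\<close>
        have bound: "(\<Sum>i<u. k i) \<le> ?G u + p j" if "p j \<le> u" for u
          using dom[of u] that by simp
        have "chosen_below (Suc t) < p j"
          using k_split[of "Suc t"] bound[of "Suc t"] t gt by simp
        then have "card (C \<inter> {..<Suc t}) \<noteq> card C"
          using C(2) by (simp add: chosen_below_def)
        then have "C \<inter> {..<Suc t} \<noteq> C"
          by (metis (no_types))
        then obtain s where "s \<in> C" "s \<notin> {..<Suc t}"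
          by blast
        then have ex: "\<exists>s\<in>C. Suc t \<le> s"
          by (auto simp: not_less)
        define s where "s = Max C"
        have sC: "s \<in> C" and s_max: "\<And>i. i \<in> C \<Longrightarrow> i \<le> s"
          using finC ex unfolding s_def by (auto intro: Max_in)
        have ts: "Suc t \<le> s"
          using ex s_max le_trans by blast
        \<comment> \<open>There are more than \<open>p j\<close> rows up to \<open>t\<close>, so
          some row \<open>u\<close> there is not chosen. Hence it is no longer than the chosen row
          \<open>s\<close> further south, which ties all rows from \<open>t\<close> to
          \<open>s\<close>.\<close>
        have "\<not> {..t} \<subseteq> C"
        proof
          assume "{..t} \<subseteq> C"
          from card_mono[OF finC this] show False
            using t C(2) by simp
        qed
        then obtain u where u: "u \<le> t" "u \<notin> C"
          by auto
        have "k u \<le> k s"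
          using first[OF sC, of u] u ts C(1) sC by (meson le_less_trans lessThan_iff not_le subsetD Suc_leD)
        then have tie: "k i = k s" if "t \<le> i" "i \<le> s" for i
          using anti[of u i] anti[of i s] u that by simp
        \<comment> \<open>The strict inequality \<open>g t < ?k t\<close> leaves room for the one
          cell that a tied row may lose. So each further row adds at least the increment of
          \<open>?G\<close>, and the excess persists until all chosen rows are counted.\<close>
        have large: "(\<Sum>i<Suc t + n. ?k i) > ?G (Suc t + n)" if "Suc t + n \<le> Suc s" for n
          using that
        proof (induction n)
          case 0
          show ?case using gt by simp
        next
          case (Suc n)
          have "g (Suc t + n) \<le> g t"
            by (rule g_anti) simp
          also have "\<dots> \<le> ?k (Suc t + n)"
            using g_less tie[of t] tie[of "Suc t + n"] Suc.prems ts by (auto simp: of_bool_def split: if_splits)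
          finally show ?case
            using Suc G_Suc[of "Suc t + n"] by simp
        qed
        have "C \<inter> {..<Suc s} = C"
          using s_max by (auto simp: less_Suc_eq_le)
        then have "chosen_below (Suc s) = p j"
          using C(2) by (simp add: chosen_below_def)
        then have "(\<Sum>i<Suc s. ?k i) \<le> ?G (Suc s)"
          using k_split[of "Suc s"] bound[of "Suc s"] t ts by linarith
        moreover have "?G (Suc s) < (\<Sum>i<Suc s. ?k i)"
          using large[of "s - t"] ts by simp
        ultimately show False
          by simp
      qed
    qed
  qed
qed

section \<open>The rows chosen for a column and the move within a row\<close>

lemma chosen_rows_subset: "chosen_rows r k M j \<subseteq> {..<r}"
  by (auto simp: chosen_rows_def)

lemma preferred_trans: "preferred M j x y \<Longrightarrow> preferred M j y z \<Longrightarrow> preferred M j x z"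
  by (auto simp: preferred_def)

lemma card_chosen_rows:
  assumes "k \<le> r"
  shows "card (chosen_rows r k M j) = k"
proof -
  have "card {x \<in> {..<r}. card {y \<in> {..<r}. preferred M j y x} < k} = k"
    by (rule card_first_elements)
      (use assms preferred_trans in \<open>auto simp: preferred_def\<close>)
  then show ?thesis
    by (simp add: chosen_rows_def)
qed

lemma chosen_rows_preferred:
  assumes "s \<in> chosen_rows r k M j" "u < r" "preferred M j u s"
  shows "u \<in> chosen_rows r k M j"
proof -
  have "card {i. i < r \<and> preferred M j i u} \<le> card {i. i < r \<and> preferred M j i s}"
    by (rule card_mono) (use assms(3) preferred_trans in auto)
  then show ?thesis
    using assms(1,2) by (auto simp: chosen_rows_def)
qed

lemma move_one_right:
  assumes "j < c"
  shows "move_one j R c = R c"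
proof (cases "\<exists>c\<le>j. R c = 1")
  case True
  then have "Max {c. c \<le> j \<and> R c = 1} \<in> {c. c \<le> j \<and> R c = 1}"
    by (intro Max_in) auto
  then show ?thesis
    using assms by (auto simp: move_one_def)
next
  case False
  then show ?thesis
    unfolding move_one_def by (subst if_not_P) auto
qed

lemma move_one_left_justified:
  assumes R: "\<And>c. c \<le> j \<Longrightarrow> R c = of_bool (c < k)" and k: "0 < k" "k \<le> Suc j"
  shows "c < j \<Longrightarrow> move_one j R c = of_bool (c < k - 1)"
    and "move_one j R j = 1"
proof -
  have ex: "\<exists>c\<le>j. R c = 1"
    using R[of 0] k by auto
  have "{c. c \<le> j \<and> R c = 1} = {..<k}"
    using R k by auto
  also have "Max \<dots> = k - 1"
    by (rule Max_eqI) (use k in auto)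
  \<comment> \<open>If the row is full, \<open>k - 1\<close> equals \<open>j\<close> and the second
    update restores the 1.\<close>
  finally have "move_one j R = (R(k - 1 := 0))(j := 1)"
    using ex by (simp add: move_one_def)
  then show "c < j \<Longrightarrow> move_one j R c = of_bool (c < k - 1)" "move_one j R j = 1"
    using R[of c] k by auto
qed

section \<open>The invariant of the construction\<close>

locale kostka_pair =
  fixes r :: nat and l m :: "nat \<Rightarrow> nat"
  assumes in_Kostka: "(l, m) \<in> Kostka r"
begin

text \<open>The matrix after the columns \<open>j, \<dots>, l 0 - 1\<close> have been processed.\<close>

definition state :: "nat \<Rightarrow> nat \<Rightarrow> nat \<Rightarrow> int" where
  "state j = fold (ryser_step r l) (rev [j..<l 0]) (initial_matrix r m)"

text \<open>By \<open>ryser_invariant\<close>, this is the length of the left-justified part of row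
  \<open>i\<close> still available to the columns below \<open>j\<close>.\<close>

definition profile :: "nat \<Rightarrow> nat \<Rightarrow> nat" where
  "profile j i = card {c. c < j \<and> state j i c = 1}"

text \<open>Columns are processed from right to left, so the choice for column \<open>j\<close>
  looks at \<open>state (Suc j)\<close>. By \<open>canonical_matrix_eq\<close>, it is the support of
  column \<open>j\<close> of the canonical matrix if \<open>j < l 0\<close>.\<close>

definition chosen :: "nat \<Rightarrow> nat set" where
  "chosen j = chosen_rows r (conjugate l j) (state (Suc j)) j"

lemma partition_l: "partition_le r l" and partition_m: "partition_le r m"
  and sum_l_eq_sum_m: "(\<Sum>i<r. l i) = (\<Sum>i<r. m i)"
  and sum_m_le_sum_l: "(\<Sum>i<t. m i) \<le> (\<Sum>i<t. l i)"
  using in_Kostka by (auto simp: Kostka_def)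

lemma state_step: "j < l 0 \<Longrightarrow> state j = ryser_step r l j (state (Suc j))"
  by (simp add: state_def upt_conv_Cons)

lemma card_columns_below: "card {c. c < l 0 \<and> c < l i} = l i"
proof -
  have "l i \<le> l 0"
    using partition_l by (auto simp: partition_le_def antimono_def)
  then have "{c. c < l 0 \<and> c < l i} = {..<l i}"
    by auto
  then show ?thesis
    by simp
qed

lemma fits_columns_m: "fits_columns r (conjugate l) (l 0) m"
proof -
  have sum_min: "(\<Sum>c<l 0. min t (conjugate l c)) = (\<Sum>i<t. l i)" for t
    using sum_min_conjugate[OF partition_l, of "{..<l 0}" t] card_columns_below by simp
  have "min r (conjugate l c) = conjugate l c" for c
    using conjugate_le[OF partition_l, of c] by simp
  then show ?thesis
    using sum_min[of r]
    by (simp add: fits_columns_def partition_m sum_min sum_m_le_sum_l sum_l_eq_sum_m)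
qed

lemma chosen_subset: "chosen j \<subseteq> {..<r}"
  unfolding chosen_def by (rule chosen_rows_subset)

lemma card_chosen: "card (chosen j) = conjugate l j"
  unfolding chosen_def by (rule card_chosen_rows) (rule conjugate_le[OF partition_l])

lemma chosen_preferred:
  assumes "s \<in> chosen j" "u < r"
    and "profile (Suc j) s < profile (Suc j) u \<or> profile (Suc j) s = profile (Suc j) u \<and> s < u"
  shows "u \<in> chosen j"
proof -
  have "ones_upto (state (Suc j)) j = profile (Suc j)"
    by (auto simp: ones_upto_def profile_def less_Suc_eq_le)
  then have "preferred (state (Suc j)) j u s"
    using assms(3) by (auto simp: preferred_def)
  with assms(1,2) show ?thesis
    unfolding chosen_def by (rule chosen_rows_preferred)
qed

lemma profile_initial: "profile (l 0) = m"
  and state_initial: "state (l 0) i c = of_bool (c < profile (l 0) i)"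
proof -
  have state: "state (l 0) i c = of_bool (c < m i)" for i c
    using partition_m by (auto simp: state_def initial_matrix_def partition_le_def not_less)
  have "{c. c < l 0 \<and> state (l 0) i c = 1} = {..<m i}" for i
    using fits_columns_bound[OF fits_columns_m, of i] by (auto simp: state)
  then show eq: "profile (l 0) = m"
    by (auto simp: profile_def)
  show "state (l 0) i c = of_bool (c < profile (l 0) i)"
    by (simp add: eq state)
qed

lemma ryser_step_invariant:
  assumes j: "j < l 0"
    and fits: "fits_columns r (conjugate l) (Suc j) (profile (Suc j))"
    and old: "\<And>i c. c \<le> j \<Longrightarrow> state (Suc j) i c = of_bool (c < profile (Suc j) i)"
  shows "profile (Suc j) i = profile j i + of_bool (i \<in> chosen j)"
    and "state j i j = of_bool (i \<in> chosen j)"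
    and "fits_columns r (conjugate l) j (profile j)"
    and "c < j \<Longrightarrow> state j i c = of_bool (c < profile j i)"
proof -
  let ?k = "profile (Suc j)" and ?k' = "\<lambda>i. profile (Suc j) i - of_bool (i \<in> chosen j)"
  note fits_step = fits_columns_step[OF fits antimono_conjugate[OF partition_l] chosen_subset
      card_chosen]
  have pos: "0 < ?k i" if "i \<in> chosen j" for i
    by (rule fits_step(1)[OF _ that]) (rule chosen_preferred)
  have full: "i \<in> chosen j" if "?k i = Suc j" for i
    by (rule fits_step(2)[OF _ that]) (rule chosen_preferred)
  have le: "?k i \<le> Suc j" for i
    by (rule fits_columns_bound[OF fits])
  have state_j: "state j i = (if i \<in> chosen j then move_one j (state (Suc j) i) else state (Suc j) i)"
    for i
    by (simp add: state_step[OF j] ryser_step_def chosen_def)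
  have new: "state j i c = of_bool (c < ?k' i)" if "c < j" for i c
    using move_one_left_justified(1)[of j "state (Suc j) i" "?k i" c] old pos[of i] le that
    by (auto simp: state_j)
  have le': "?k' i \<le> j" for i
    using le[of i] full[of i] by (cases "?k i = Suc j") auto
  have "{c. c < j \<and> state j i c = 1} = {..<?k' i}" for i
  proof (intro set_eqI)
    show "c \<in> {c. c < j \<and> state j i c = 1} \<longleftrightarrow> c \<in> {..<?k' i}" for c
      using new[of c i] le'[of i] by (cases "c < j") auto
  qed
  then have profile: "profile j = ?k'"
    by (auto simp: profile_def)
  have "fits_columns r (conjugate l) j ?k'"
    by (rule fits_step(3)) (rule chosen_preferred)
  then show "fits_columns r (conjugate l) j (profile j)"
    by (simp add: profile)
  show "c < j \<Longrightarrow> state j i c = of_bool (c < profile j i)"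
    using new profile by simp
  show "profile (Suc j) i = profile j i + of_bool (i \<in> chosen j)"
    using pos[of i] by (simp add: profile)
  have "i \<in> chosen j \<Longrightarrow> move_one j (state (Suc j) i) j = 1"
    by (rule move_one_left_justified(2)[OF old pos le])
  moreover have "i \<notin> chosen j \<Longrightarrow> state (Suc j) i j = 0"
    using old[of j i] le[of i] full[of i] by (cases "?k i = Suc j") auto
  ultimately show "state j i j = of_bool (i \<in> chosen j)"
    by (simp add: state_j)
qed

lemma ryser_invariant:
  assumes "j \<le> l 0"
  shows "fits_columns r (conjugate l) j (profile j) \<and>
    (\<forall>i. \<forall>c<j. state j i c = of_bool (c < profile j i))"
  using assms
proof (induction rule: inc_induct)
  case base
  show ?case
    using fits_columns_m by (simp add: profile_initial state_initial)
next
  case (step j)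
  then show ?case
    using ryser_step_invariant(3,4)[of j] by (auto simp: less_Suc_eq_le)
qed

lemma profile_Suc:
  assumes "j < l 0"
  shows "profile (Suc j) i = profile j i + of_bool (i \<in> chosen j)"
  by (rule ryser_step_invariant(1)) (use assms ryser_invariant[of "Suc j"] in auto)

lemma state_diagonal:
  assumes "j < l 0"
  shows "state j i j = of_bool (i \<in> chosen j)"
  by (rule ryser_step_invariant(2)) (use assms ryser_invariant[of "Suc j"] in auto)

text \<open>Column \<open>j\<close> gets its final entries when it is processed, because a later
  step \<open>d < j\<close> changes no column beyond \<open>d\<close>.\<close>

lemma canonical_matrix_eq:
  assumes "j < l 0"
  shows "canonical_matrix r l m i j = of_bool (i \<in> chosen j)"
proof -
  have "state d i j = state j i j" if "d \<le> j" for d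
    using that
  proof (induction rule: inc_induct)
    case (step d)
    then have "state d i j = state (Suc d) i j"
      using assms by (simp add: state_step[of d] ryser_step_def move_one_right)
    then show ?case
      using step by simp
  qed simp
  from this[of 0] show ?thesis
    using state_diagonal[OF assms] by (simp add: canonical_matrix_def state_def)
qed

lemma profile_antimono:
  assumes "j \<le> l 0" "u \<le> s"
  shows "profile j s \<le> profile j u"
  using ryser_invariant[OF assms(1)] assms(2)
  by (auto simp: fits_columns_def partition_le_def antimono_def)

lemma profile_eq_sum:
  assumes "j \<le> l 0"
  shows "profile j i = (\<Sum>c<j. of_bool (i \<in> chosen c))"
  using assms by (induction j) (auto simp: profile_def[of 0] profile_Suc)

text \<open>A row north of a chosen row is at least as long, and if it were strictly longer it would
  be chosen. So \<open>u\<close> and \<open>s\<close> tie, and antitonicity extends the tie to all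
  rows between them.\<close>

lemma chosen_tie:
  assumes "j < l 0" "s \<in> chosen j" "u \<notin> chosen j" "u \<le> i" "i \<le> s"
  shows "profile (Suc j) i = profile (Suc j) s"
proof -
  have "u < r"
    using assms chosen_subset[of j] by (meson le_less_trans le_trans lessThan_iff subsetD)
  then have "profile (Suc j) u \<le> profile (Suc j) s"
    using chosen_preferred[of s j u] assms by force
  moreover have "profile (Suc j) s \<le> profile (Suc j) i" "profile (Suc j) i \<le> profile (Suc j) u"
    using assms by (auto intro: profile_antimono)
  ultimately show ?thesis
    by simp
qed

lemma chosen_southern:
  assumes "u \<in> chosen j" "u \<le> s" "s < r" "profile (Suc j) u = profile (Suc j) s"
  shows "s \<in> chosen j"
  using chosen_preferred[of u j s] assms by (cases "u = s") auto

end

section \<open>Sign patterns of rows and columns\<close>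

context kostka_pair
begin

abbreviation star :: "nat \<Rightarrow> nat \<Rightarrow> int" where
  "star \<equiv> star_matrix r l m"

lemma star_eq:
  assumes "j < l 0"
  shows "star i j = of_bool (i \<in> chosen j) - of_bool (Suc i \<in> chosen j)"
  using assms by (simp add: star_matrix_def canonical_matrix_eq)

lemma star_eq_1_iff: "j < l 0 \<Longrightarrow> star i j = 1 \<longleftrightarrow> i \<in> chosen j \<and> Suc i \<notin> chosen j"
  and star_eq_m1_iff: "j < l 0 \<Longrightarrow> star i j = -1 \<longleftrightarrow> i \<notin> chosen j \<and> Suc i \<in> chosen j"
  and star_cases: "j < l 0 \<Longrightarrow> star i j \<noteq> 0 \<Longrightarrow> star i j = 1 \<or> star i j = -1"
  by (auto simp: star_eq)

lemma star_nonzero_row: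
  assumes "j < l 0" "star i j \<noteq> 0"
  shows "i < r"
  using assms chosen_subset[of j] by (auto simp: star_eq of_bool_def split: if_splits)

lemma mem_kgr_verts_iff: "(i, j) \<in> kgr_verts r l m \<longleftrightarrow> j < l 0 \<and> star i j \<noteq> 0"
  using star_nonzero_row by (auto simp: kgr_verts_def)

text \<open>By \<open>profile_Suc\<close>, \<open>profile j i\<close> counts the ones of row
  \<open>i\<close> in the first \<open>j\<close> columns of the canonical matrix. Partial row sums
  of the star matrix thus compare neighbouring row lengths.\<close>

lemma sum_star:
  assumes "j \<le> l 0"
  shows "(\<Sum>c<j. star i c) = int (profile j i) - int (profile j (Suc i))"
  using assms by (induction j) (auto simp: star_eq profile_Suc profile_def[of 0])

lemma profile_eq_of_star_m1:
  assumes "j < l 0" "star i j = -1"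
  shows "profile (Suc j) i = profile (Suc j) (Suc i)"
  using assms chosen_tie[of j "Suc i" i i] by (auto simp: star_eq_m1_iff)

lemma sum_star_of_star_m1:
  assumes "j < l 0" "star i j = -1"
  shows "(\<Sum>c<Suc j. star i c) = 0" "(\<Sum>c<j. star i c) = 1"
  using sum_star[of "Suc j" i] profile_eq_of_star_m1[OF assms] assms by auto

text \<open>
  The partial row sums are nonnegative, drop to 0 at every -1 and hence equal 1 just before it:
  the last nonzero entry before a -1 is a 1.
\<close>

lemma star_m1_matched:
  assumes j: "j < l 0" "star i j = -1"
  obtains k where "k < j" "star i k = 1" "\<And>c. k < c \<Longrightarrow> c < j \<Longrightarrow> star i c = 0"
proof -
  let ?N = "{c. c < j \<and> star i c \<noteq> 0}"
  have "?N \<noteq> {}"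
  proof
    assume "?N = {}"
    then have "(\<Sum>c<j. star i c) = 0"
      by (intro sum.neutral) auto
    then show False
      using sum_star_of_star_m1(2)[OF j] by simp
  qed
  then have "Max ?N \<in> ?N"
    by (intro Max_in) auto
  moreover define k where "k = Max ?N"
  ultimately have k: "k < j" "star i k \<noteq> 0"
    by auto
  have zero: "star i c = 0" if "k < c" "c < j" for c
  proof (rule ccontr)
    assume "star i c \<noteq> 0"
    with that have "c \<le> k"
      unfolding k_def by (intro Max_ge) auto
    with that show False
      by simp
  qed
  \<comment> \<open>The sum through column \<open>k\<close> is still 1, whereas a -1 in column
    \<open>k\<close> would make it 0.\<close>
  have "(\<Sum>c<Suc k. star i c) = (\<Sum>c<j. star i c)"
    by (rule sum.mono_neutral_left) (use k zero in auto)
  then have "star i k \<noteq> -1"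
    using sum_star_of_star_m1(1)[of k i] sum_star_of_star_m1(2)[OF j] j k
    by auto
  then show thesis
    using that[of k] k zero star_cases[of k i] j by auto
qed

text \<open>The definition only forbids a 1 strictly between the ends. By
  \<open>star_m1_matched\<close> the last nonzero entry before a -1 is a 1, so all entries in
  between vanish.\<close>

lemma horizontal_iff:
  "((i, j), (i', k)) \<in> kgr_horizontal r l m \<longleftrightarrow>
     i' = i \<and> j < l 0 \<and> star i j = -1 \<and> k < j \<and> star i k = 1 \<and>
     (\<forall>c. k < c \<and> c < j \<longrightarrow> star i c = 0)"
  (is "?L \<longleftrightarrow> ?R")
proof
  assume ?L
  then have L: "i' = i" "j < l 0" "star i j = -1" "k < j" "star i k = 1"
    and no1: "\<And>c. k < c \<Longrightarrow> c < j \<Longrightarrow> star i c \<noteq> 1"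
    by (auto simp: kgr_horizontal_def mem_kgr_verts_iff)
  obtain k' where k': "k' < j" "star i k' = 1" "\<And>c. k' < c \<Longrightarrow> c < j \<Longrightarrow> star i c = 0"
    using star_m1_matched[OF L(2,3)] by blast
  have "k' = k"
    using no1[of k'] k'(1,2) k'(3)[of k] L(4,5) by (cases k k' rule: linorder_cases) auto
  then show ?R
    using L k' by simp
next
  assume ?R
  then show ?L
    by (auto simp: kgr_horizontal_def mem_kgr_verts_iff)
qed

lemma vertical_iff:
  "((i, j), (k, j')) \<in> kgr_vertical r l m \<longleftrightarrow>
     j' = j \<and> j < l 0 \<and> star i j = 1 \<and> star k j = -1"
  by (auto simp: kgr_vertical_def mem_kgr_verts_iff)

lemma horizontal_exists:
  assumes "j < l 0" "star i j = -1"
  obtains k where "((i, j), (i, k)) \<in> kgr_horizontal r l m"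
  using star_m1_matched[OF assms] assms by (metis horizontal_iff)

lemma horizontal_unique_target:
  assumes "((i, j), (i', k)) \<in> kgr_horizontal r l m" "((i, j), (i'', k')) \<in> kgr_horizontal r l m"
  shows "k = k'"
  using assms unfolding horizontal_iff by (cases k k' rule: linorder_cases) auto

lemma horizontal_unique_source:
  assumes "((i, j), (i', k)) \<in> kgr_horizontal r l m" "((i, j'), (i'', k)) \<in> kgr_horizontal r l m"
  shows "j = j'"
  using assms unfolding horizontal_iff by (cases j j' rule: linorder_cases) auto

text \<open>The partial sums of row \<open>i\<close> keep the value 1 from the 1 up to just before
  the -1, and by \<open>sum_star\<close> they are the difference of the two row lengths.\<close>

lemma profile_gap_inside_horizontal:
  assumes "((i, j), (i', k)) \<in> kgr_horizontal r l m" "k < c" "c < j"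
  shows "profile (Suc c) i \<noteq> profile (Suc c) (Suc i)"
proof -
  have h: "j < l 0" "star i j = -1" and zero: "\<And>c. k < c \<Longrightarrow> c < j \<Longrightarrow> star i c = 0"
    using assms(1) by (auto simp: horizontal_iff)
  have "(\<Sum>c<Suc c. star i c) = (\<Sum>c<j. star i c)"
    by (rule sum.mono_neutral_left) (use assms zero in auto)
  then show ?thesis
    using sum_star[of "Suc c" i] sum_star_of_star_m1(2)[OF h] assms h by simp
qed

text \<open>For \<open>i < i'\<close>, the rows from \<open>i\<close> to \<open>Suc i'\<close> are
  tied. As \<open>Suc i\<close> is chosen, breaking ties to the south makes \<open>i'\<close> chosen
  too, which a -1 in row \<open>i'\<close> forbids.\<close>

lemma star_m1_unique:
  assumes j: "j < l 0" and "star i j = -1" "star i' j = -1"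
  shows "i = i'"
proof -
  have False if "i < i'" "star i j = -1" "star i' j = -1" for i i'
  proof -
    have i: "i \<notin> chosen j" "Suc i \<in> chosen j" and i': "i' \<notin> chosen j" "Suc i' \<in> chosen j"
      using that j by (auto simp: star_eq_m1_iff)
    have "profile (Suc j) (Suc i) = profile (Suc j) (Suc i')"
      "profile (Suc j) i' = profile (Suc j) (Suc i')"
      by (rule chosen_tie[OF j i'(2) i(1)]; use that(1) in simp)+
    moreover have "i' < r"
      using i'(2) chosen_subset[of j] by auto
    ultimately have "i' \<in> chosen j"
      using chosen_southern[OF i(2), of i'] that(1) by simp
    with i'(1) show False
      by simp
  qed
  then show ?thesis
    using assms by (metis linorder_neqE_nat)
qed

lemma column_has_1_of_m1:
  assumes j: "j < l 0" and "star x j = -1"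
  obtains y where "star y j = 1"
proof -
  have fin: "finite (chosen j)"
    using chosen_subset finite_subset by blast
  have ne: "chosen j \<noteq> {}"
    using assms by (auto simp: star_eq_m1_iff)
  have "Suc (Max (chosen j)) \<notin> chosen j"
    using Max_ge[OF fin] by (metis Suc_n_not_le_n)
  then show thesis
    using that[of "Max (chosen j)"] Max_in[OF fin ne] j by (simp add: star_eq_1_iff)
qed

text \<open>The last unchosen row north of \<open>i'\<close> carries a -1; there is one because
  \<open>Suc i\<close> is unchosen.\<close>

lemma column_has_m1_of_two_1s:
  assumes j: "j < l 0" and "i < i'" "star i j = 1" "star i' j = 1"
  obtains x where "star x j = -1"
proof -
  let ?N = "{y. y < i' \<and> y \<notin> chosen j}"
  have i: "Suc i \<notin> chosen j" "i' \<in> chosen j"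
    using assms by (auto simp: star_eq_1_iff)
  then have "Suc i \<in> ?N"
    using assms(2) by (cases "Suc i = i'") auto
  then have x: "Max ?N \<in> ?N"
    by (intro Max_in) auto
  have "Suc (Max ?N) \<notin> ?N"
  proof
    assume "Suc (Max ?N) \<in> ?N"
    from Max_ge[OF _ this] show False
      by simp
  qed
  then have "Suc (Max ?N) \<in> chosen j"
    using x i(2) by (cases "Suc (Max ?N) = i'") auto
  then show thesis
    using that[of "Max ?N"] x j by (simp add: star_eq_m1_iff)
qed

text \<open>\<open>chosen_tie\<close> needs an unchosen row in the north and a chosen one in the
  south. If the 1 is north of the -1, these are \<open>Suc i\<close> and \<open>Suc k\<close>;
  otherwise they are \<open>k\<close> and \<open>i\<close> themselves.\<close>

lemma profile_inside_vertical:
  assumes v: "((i, c), (k, c)) \<in> kgr_vertical r l m" and x: "min i k < x" "x < max i k"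
  shows "profile (Suc c) x = profile (Suc c) (Suc x)" and "Suc x < r"
proof -
  have c: "c < l 0" and i: "i \<in> chosen c" "Suc i \<notin> chosen c"
    and k: "k \<notin> chosen c" "Suc k \<in> chosen c"
    using v by (auto simp: vertical_iff star_eq_1_iff star_eq_m1_iff)
  have "i < r" "Suc k < r"
    using i k chosen_subset[of c] by auto
  then show "Suc x < r"
    using x by auto
  show "profile (Suc c) x = profile (Suc c) (Suc x)"
  proof (cases "i < k")
    case True
    then show ?thesis
      using chosen_tie[OF c k(2) i(2), of x] chosen_tie[OF c k(2) i(2), of "Suc x"] x by simp
  next
    case False
    then show ?thesis
      using chosen_tie[OF c i(1) k(1), of x] chosen_tie[OF c i(1) k(1), of "Suc x"] x by simp
  qed
qed

text \<open>A second -1 is excluded by uniqueness. A 1 in row \<open>x\<close> would leave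
  \<open>Suc x\<close> unchosen although it ties with the chosen row \<open>x\<close> to its
  north.\<close>

lemma star_inside_vertical:
  assumes v: "((i, c), (k, c)) \<in> kgr_vertical r l m" and x: "min i k < x" "x < max i k"
  shows "star x c = 0"
proof (rule ccontr)
  assume nz: "star x c \<noteq> 0"
  have c: "c < l 0" and k: "star k c = -1"
    using v by (auto simp: vertical_iff)
  have "star x c \<noteq> -1"
    using star_m1_unique[OF c k, of x] x by auto
  then have "x \<in> chosen c" "Suc x \<notin> chosen c"
    using star_cases[OF c nz] c by (auto simp: star_eq_1_iff)
  then show False
    using chosen_southern[of x c "Suc x"] profile_inside_vertical[OF assms] by simp
qed

end

section \<open>Forests and components\<close>

lemma mem_parcs_mk_symmetric_iff:
  "(u, v) \<in> parcs (mk_symmetric (with_proj G)) \<longleftrightarrow> (u, v) \<in> parcs G \<or> (v, u) \<in> parcs G"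
  by (auto simp: parcs_mk_symmetric Bex_def)

lemma mem_graph_sources_iff:
  "v \<in> graph_sources G \<longleftrightarrow> v \<in> pverts G \<and> (\<forall>u. (u, v) \<notin> parcs G)"
  by (force simp: graph_sources_def in_arcs_def)

lemma mem_graph_sinks_iff:
  "v \<in> graph_sinks G \<longleftrightarrow> v \<in> pverts G \<and> (\<forall>w. (v, w) \<notin> parcs G)"
  by (force simp: graph_sinks_def out_arcs_def)

lemma pcas_nth:
  assumes "pcas u p v" "i < length p"
  shows "fst (p ! i) = (if i = 0 then u else snd (p ! (i - 1)))"
    and "Suc i = length p \<Longrightarrow> snd (p ! i) = v"
  using assms
  by (induction p arbitrary: u i) (auto simp: nth_Cons split: nat.splits if_splits)

lemma tl_pawalk_verts: "pcas u p v \<Longrightarrow> tl (pawalk_verts u p) = map snd p"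
proof (induction p arbitrary: u)
  case (Cons e p)
  then have "pcas (snd e) p v"
    by simp
  with Cons.IH[of "snd e"] show ?case
    by (cases p) auto
qed simp

text \<open>
  On an undirected cycle of length at least 3, both cycle edges at a vertex of maximal rank
  point away from it.
\<close>

lemma undirected_forest_of_rank:
  fixes rank :: "'a \<Rightarrow> nat"
  assumes rank: "\<And>u v. (u, v) \<in> parcs G \<Longrightarrow> rank v < rank u"
    and out: "\<And>u v w. (u, v) \<in> parcs G \<Longrightarrow> (u, w) \<in> parcs G \<Longrightarrow> v = w"
  shows "undirected_forest G"
  unfolding undirected_forest_def
proof
  let ?S = "with_proj (mk_symmetric (with_proj G))"
  assume "\<exists>p. pre_digraph.cycle ?S p \<and> length p \<noteq> 2"
  then obtain p u where walk: "pre_digraph.awalk ?S u p u"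
    and dist: "distinct (tl (pawalk_verts u p))" and ne: "p \<noteq> []" and len: "length p \<noteq> 2"
    unfolding pre_digraph.cycle_def awalk_verts_with_proj_eq by auto
  from walk have cas: "pcas u p u" and arcs: "set p \<subseteq> parcs (mk_symmetric (with_proj G))"
    by (auto simp: pre_digraph.awalk_def cas_with_proj_eq)
  have down: "(v, w) \<in> parcs G" if "(v, w) \<in> set p \<or> (w, v) \<in> set p" "rank w \<le> rank v" for v w
    using that subsetD[OF arcs] rank[of w v] by (fastforce simp: mem_parcs_mk_symmetric_iff)
  have inj: "i = j" if "i < length p" "j < length p" "snd (p ! i) = snd (p ! j)" for i j
    using dist that nth_eq_iff_index_eq[of "map snd p" i j] by (simp add: tl_pawalk_verts[OF cas])
  \<comment> \<open>Indices are cyclic because the walk is closed: the neighbours of the vertex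
    \<open>snd (p ! i)\<close> are the heads at the previous and the next index.\<close>
  define next_idx where "next_idx i = (if Suc i = length p then 0 else Suc i)" for i
  define prev_idx where "prev_idx i = (if i = 0 then length p - 1 else i - 1)" for i
  have idx: "next_idx i < length p" "prev_idx i < length p" if "i < length p" for i
    using that ne by (auto simp: next_idx_def prev_idx_def)
  have next_fst: "fst (p ! next_idx i) = snd (p ! i)" if "i < length p" for i
    using pcas_nth(1)[OF cas, of "Suc i"] pcas_nth(1)[OF cas, of 0] pcas_nth(2)[OF cas, of i] that ne
    by (auto simp: next_idx_def)
  have prev_snd: "snd (p ! prev_idx i) = fst (p ! i)" if "i < length p" for i
    using pcas_nth(1)[OF cas, of i] pcas_nth(2)[OF cas, of "length p - 1"] that ne
    by (auto simp: prev_idx_def)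
  obtain i where i: "i < length p" and max: "\<And>j. j < length p \<Longrightarrow> rank (snd (p ! j)) \<le> rank (snd (p ! i))"
  proof -
    let ?R = "(\<lambda>j. rank (snd (p ! j))) ` {..<length p}"
    have "Max ?R \<in> ?R"
      using ne by (intro Max_in) auto
    then obtain i where i: "i < length p" "rank (snd (p ! i)) = Max ?R"
      by auto
    have "rank (snd (p ! j)) \<le> Max ?R" if "j < length p" for j
      using that by (intro Max_ge) auto
    with that i show thesis
      by metis
  qed
  let ?v = "snd (p ! i)" and ?x = "snd (p ! prev_idx i)" and ?w = "snd (p ! next_idx i)"
  have "(?x, ?v) \<in> set p"
    using prev_snd[OF i] nth_mem[OF i] by simp
  then have x: "(?v, ?x) \<in> parcs G"
    using down max[OF idx(2)[OF i]] by blast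
  have "(?v, ?w) \<in> set p"
    using next_fst[OF i] nth_mem[OF idx(1)[OF i]] by (metis prod.collapse)
  then have w: "(?v, ?w) \<in> parcs G"
    using down max[OF idx(1)[OF i]] by blast
  \<comment> \<open>The two neighbours coincide because out-arcs are unique. Distinctness then
    leaves only lengths 1 and 2: the first is a loop, impossible by rank, and the second is excluded
    by assumption.\<close>
  have "prev_idx i = next_idx i"
    by (rule inj[OF idx(2)[OF i] idx(1)[OF i]]) (rule out[OF x w])
  moreover have "length p \<noteq> 1"
  proof
    assume "length p = 1"
    then have "next_idx i = i"
      using i by (simp add: next_idx_def)
    then show False
      using rank[OF w] by simp
  qed
  ultimately show False
    using i len by (auto simp: next_idx_def prev_idx_def split: if_splits)
qed

section \<open>Connected components and maximality\<close>

lemma connected_extend: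
  assumes H: "Digraph_Component.connected (with_proj H)"
    and sub: "pverts H \<subseteq> pverts H'" "parcs H \<subseteq> parcs H'"
    and adj: "\<And>v. v \<in> pverts H' \<Longrightarrow> v \<in> pverts H \<or> (\<exists>u\<in>pverts H. (u, v) \<in> parcs H' \<or> (v, u) \<in> parcs H')"
  shows "Digraph_Component.connected (with_proj H')"
proof -
  let ?R = "\<lambda>H. rtrancl_on (pverts H) (parcs (mk_symmetric (with_proj H)))"
  have reach_iff: "u \<rightarrow>\<^sup>*\<^bsub>with_proj (mk_symmetric (with_proj H))\<^esub> v \<longleftrightarrow> (u, v) \<in> ?R H" for H :: "'a pair_pre_digraph" and u v
    by (simp add: reachable_def)
  have mono: "(u, v) \<in> ?R H'" if "(u, v) \<in> ?R H" for u v
    using that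
  proof (induction rule: rtrancl_on_induct)
    case base
    then show ?case using sub by auto
  next
    case (step y z)
    have "(y, z) \<in> parcs (mk_symmetric (with_proj H'))"
      using step(2) sub(2) by (auto simp: mem_parcs_mk_symmetric_iff)
    with step sub(1) show ?case
      by (blast intro: rtrancl_on_into_rtrancl_on)
  qed
  have near: "\<exists>u\<in>pverts H. (u, v) \<in> ?R H' \<and> (v, u) \<in> ?R H'" if v: "v \<in> pverts H'" for v
  proof (cases "v \<in> pverts H")
    case True
    then show ?thesis
      using v by auto
  next
    case False
    then obtain u where u: "u \<in> pverts H" "(u, v) \<in> parcs H' \<or> (v, u) \<in> parcs H'"
      using adj[OF v] by auto
    then have sym: "(u, v) \<in> parcs (mk_symmetric (with_proj H'))"
      "(v, u) \<in> parcs (mk_symmetric (with_proj H'))"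
      by (auto simp: mem_parcs_mk_symmetric_iff)
    have "u \<in> pverts H'"
      using u sub by auto
    then have "(u, v) \<in> ?R H'" "(v, u) \<in> ?R H'"
      using sym v by (meson rtrancl_on_refl rtrancl_on_into_rtrancl_on)+
    with u show ?thesis
      by auto
  qed
  have "(a, b) \<in> ?R H'" if a: "a \<in> pverts H'" and b: "b \<in> pverts H'" for a b
  proof -
    obtain u where u: "u \<in> pverts H" "(a, u) \<in> ?R H'"
      using near[OF a] by auto
    obtain v where v: "v \<in> pverts H" "(v, b) \<in> ?R H'"
      using near[OF b] by auto
    have "(u, v) \<in> ?R H"
      using H u(1) v(1) by (auto simp: connected_def strongly_connected_def reach_iff)
    then show ?thesis
      using mono u v by (meson rtrancl_on_trans)
  qed
  moreover have "pverts H' \<noteq> {}"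
    using H sub by (auto simp: connected_def strongly_connected_def)
  ultimately show ?thesis
    by (auto simp: connected_def strongly_connected_def reach_iff)
qed

text \<open>Maximality in usable form: enlarging \<open>H\<close> by arcs and by vertices adjacent
  to it keeps it connected, so no such enlargement is proper.\<close>

lemma component_maximal:
  fixes G H H' :: "'a pair_pre_digraph"
  assumes comp: "connected_component_of H G"
    and sub: "pverts H \<subseteq> pverts H'" "parcs H \<subseteq> parcs H'" "pverts H' \<subseteq> pverts G" "parcs H' \<subseteq> parcs G"
    and wf: "\<And>u v. (u, v) \<in> parcs H' \<Longrightarrow> u \<in> pverts H' \<and> v \<in> pverts H'"
    and adj: "\<And>v. v \<in> pverts H' \<Longrightarrow> v \<in> pverts H \<or> (\<exists>u\<in>pverts H. (u, v) \<in> parcs H' \<or> (v, u) \<in> parcs H')"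
  shows "pverts H' = pverts H \<and> parcs H' = parcs H"
proof -
  have H: "subgraph (with_proj H) (with_proj G)" "Digraph_Component.connected (with_proj H)"
    and max: "\<And>K. K \<noteq> with_proj H \<Longrightarrow> subgraph (with_proj H) K \<Longrightarrow> subgraph K (with_proj G) \<Longrightarrow>
      \<not> Digraph_Component.connected K"
    using comp by (auto simp: connected_component_of_def pre_digraph.max_subgraph_def)
  have wf': "wf_digraph (with_proj H')"
    by unfold_locales (use wf in \<open>auto\<close>)
  have "subgraph (with_proj H) (with_proj H')" "subgraph (with_proj H') (with_proj G)"
    using H(1) wf' sub by (auto simp: subgraph_def compatible_def)
  moreover have "Digraph_Component.connected (with_proj H')"
    using H(2) sub(1,2) adj by (rule connected_extend)
  ultimately have "with_proj H' = with_proj H"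
    using max by blast
  then show ?thesis
    by (simp add: with_proj_def)
qed

lemma wf_with_projD:
  assumes "wf_digraph (with_proj G)" "(u, v) \<in> parcs G"
  shows "u \<in> pverts G" "v \<in> pverts G"
  using wf_digraph.tail_in_verts[OF assms(1), of "(u, v)"]
    wf_digraph.head_in_verts[OF assms(1), of "(u, v)"] assms(2) by auto

lemma component_arc_closed:
  assumes comp: "connected_component_of H G" and uv: "(u, v) \<in> parcs G"
  shows "u \<in> pverts H \<longleftrightarrow> v \<in> pverts H"
proof (rule ccontr)
  assume neq: "\<not> ?thesis"
  let ?H = "\<lparr>pverts = pverts H \<union> {u, v}, parcs = insert (u, v) (parcs H)\<rparr>"
  have sub: "subgraph (with_proj H) (with_proj G)"
    using comp by (auto simp: connected_component_of_def pre_digraph.max_subgraph_def)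
  then have wfH: "wf_digraph (with_proj H)" and wfG: "wf_digraph (with_proj G)"
    by (auto simp: subgraph_def)
  have "pverts ?H = pverts H \<and> parcs ?H = parcs H"
  proof (rule component_maximal[OF comp])
    show "pverts ?H \<subseteq> pverts G" "parcs ?H \<subseteq> parcs G"
      using sub uv wf_with_projD[OF wfG uv] by (auto simp: subgraph_def)
    show "x \<in> pverts ?H \<and> y \<in> pverts ?H" if "(x, y) \<in> parcs ?H" for x y
      using that wf_with_projD[OF wfH] by auto
  qed (use neq in auto)
  with neq show False
    by auto
qed

lemma component_spanning:
  assumes comp: "connected_component_of H G" and "pverts H = pverts G"
  shows "H = G"
proof -
  have sub: "subgraph (with_proj H) (with_proj G)"
    using comp by (auto simp: connected_component_of_def pre_digraph.max_subgraph_def)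
  then have wfG: "wf_digraph (with_proj G)"
    by (auto simp: subgraph_def)
  have "pverts G = pverts H \<and> parcs G = parcs H"
    by (rule component_maximal[OF comp])
      (use assms(2) sub wf_with_projD[OF wfG] in \<open>auto simp: subgraph_def\<close>)
  then show ?thesis
    by simp
qed

section \<open>The KGR graph as a plane forest\<close>

lemma closed_segment_horizontal:
  fixes a b y :: real
  shows "closed_segment (a, y) (b, y) = closed_segment a b \<times> {y}"
  by (force simp: closed_segment_def algebra_simps)

lemma closed_segment_vertical:
  fixes a b x :: real
  shows "closed_segment (x, a) (x, b) = {x} \<times> closed_segment a b"
  by (force simp: closed_segment_def algebra_simps)

lemma fst_matrix_position [simp]: "fst (matrix_position (i, j)) = real j"
  and snd_matrix_position [simp]: "snd (matrix_position (i, j)) = - real i"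
  by (simp_all add: matrix_position_def)

lemma matrix_position_eqI: "fst p = real j \<Longrightarrow> snd p = - real i \<Longrightarrow> p = matrix_position (i, j)"
  by (simp add: prod_eq_iff)

lemma mem_segment_horizontal:
  "k \<le> j \<Longrightarrow> p \<in> closed_segment (matrix_position (i, j)) (matrix_position (i, k)) \<longleftrightarrow>
     real k \<le> fst p \<and> fst p \<le> real j \<and> snd p = - real i"
  by (cases p) (auto simp: matrix_position_def closed_segment_horizontal closed_segment_eq_real_ivl)

lemma mem_segment_vertical:
  "p \<in> closed_segment (matrix_position (i, c)) (matrix_position (k, c)) \<longleftrightarrow>
     fst p = real c \<and> - real (max i k) \<le> snd p \<and> snd p \<le> - real (min i k)"
  by (cases p) (auto simp: matrix_position_def closed_segment_vertical closed_segment_eq_real_ivl)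

context kostka_pair
begin

lemma pverts_kgr_graph: "pverts (kgr_graph r l m) = kgr_verts r l m"
  and parcs_kgr_graph: "parcs (kgr_graph r l m) = kgr_horizontal r l m \<union> kgr_vertical r l m"
  by (simp_all add: kgr_graph_def)

lemma kgr_arc_cases:
  assumes "(u, v) \<in> parcs (kgr_graph r l m)"
  obtains (horizontal) i j k where "u = (i, j)" "v = (i, k)" "((i, j), (i, k)) \<in> kgr_horizontal r l m"
    | (vertical) i k c where "u = (i, c)" "v = (k, c)" "((i, c), (k, c)) \<in> kgr_vertical r l m"
  using assms by (cases u; cases v) (auto simp: parcs_kgr_graph horizontal_iff vertical_iff)

text \<open>The sign at the tail decides the kind of arc: a -1 has only its horizontal arc, and a 1
  can only point to the unique -1 of its column.\<close>

lemma kgr_out_unique: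
  assumes "(u, v) \<in> parcs (kgr_graph r l m)" "(u, w) \<in> parcs (kgr_graph r l m)"
  shows "v = w"
  using assms(1)
proof (cases rule: kgr_arc_cases)
  case h: (horizontal i j k)
  from assms(2) show ?thesis
  proof (cases rule: kgr_arc_cases)
    case (horizontal i' j' k')
    then show ?thesis
      using h horizontal_unique_target by blast
  qed (use h in \<open>simp add: horizontal_iff vertical_iff\<close>)
next
  case v: (vertical i k c)
  from assms(2) show ?thesis
  proof (cases rule: kgr_arc_cases)
    case (vertical i' k' c')
    then show ?thesis
      using v star_m1_unique[of c k k'] by (simp add: vertical_iff)
  qed (use v in \<open>simp add: horizontal_iff vertical_iff\<close>)
qed

text \<open>A horizontal arc lowers the column but leads from a -1 to a 1; a vertical one keeps the
  column and leads from a 1 to a -1. Doubling the column makes both strict descents.\<close>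

definition rank :: "nat \<times> nat \<Rightarrow> nat" where
  "rank v = 2 * snd v + of_bool (star (fst v) (snd v) = 1)"

lemma rank_decreasing:
  assumes "(u, v) \<in> parcs (kgr_graph r l m)"
  shows "rank v < rank u"
  using assms by (cases rule: kgr_arc_cases) (auto simp: rank_def horizontal_iff vertical_iff)

text \<open>Descent of the rank and uniqueness of out-arcs pass to fewer arcs, so conservative
  subtrees are covered too.\<close>

lemma undirected_forest_subgraph:
  assumes "parcs H \<subseteq> parcs (kgr_graph r l m)"
  shows "undirected_forest H"
  using assms rank_decreasing kgr_out_unique by (intro undirected_forest_of_rank[of _ rank]) blast+

section \<open>Arcs meet only in common ends\<close>

lemma vertex_on_arc:
  assumes uv: "(u, v) \<in> parcs (kgr_graph r l m)" and w: "w \<in> kgr_verts r l m"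
    and on: "matrix_position w \<in> closed_segment (matrix_position u) (matrix_position v)"
  shows "w \<in> {u, v}"
proof -
  obtain x c where w_eq: "w = (x, c)"
    by (cases w)
  from w have nz: "star x c \<noteq> 0"
    by (simp add: w_eq mem_kgr_verts_iff)
  from uv show ?thesis
  proof (cases rule: kgr_arc_cases)
    case (horizontal i j k)
    then have "k \<le> j" and zero: "\<And>c. k < c \<Longrightarrow> c < j \<Longrightarrow> star i c = 0"
      by (auto simp: horizontal_iff)
    then have "x = i" "k \<le> c" "c \<le> j"
      using on horizontal by (auto simp: mem_segment_horizontal w_eq)
    then show ?thesis
      using zero[of c] nz horizontal w_eq by (auto simp: le_less)
  next
    case (vertical i k d)
    then have "c = d" "min i k \<le> x" "x \<le> max i k"
      using on by (auto simp: mem_segment_vertical w_eq)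
    then show ?thesis
      using star_inside_vertical[OF vertical(3), of x] nz vertical w_eq
      by (cases "min i k < x \<and> x < max i k") (auto simp: min_def max_def split: if_splits)
  qed
qed

text \<open>If the meeting point is not a vertex, it lies strictly inside both arcs. Then the
  vertical arc forces rows \<open>i\<close> and \<open>Suc i\<close> to have equal length in
  \<open>profile (Suc c)\<close>, and the horizontal arc forbids it. A vertex on both arcs is an end
  of both.\<close>

lemma horizontal_vertical_meet:
  assumes h: "((i, j), (i, k)) \<in> kgr_horizontal r l m"
    and v: "((a, c), (b, c)) \<in> kgr_vertical r l m"
    and ends: "k \<le> c" "c \<le> j" "min a b \<le> i" "i \<le> max a b"
  shows "(i, c) \<in> {(i, j), (i, k)} \<inter> {(a, c), (b, c)}"
proof -
  have vert: "(i, c) \<in> kgr_verts r l m"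
  proof (rule ccontr)
    assume no: "(i, c) \<notin> kgr_verts r l m"
    have "(i, j) \<in> kgr_verts r l m" "(i, k) \<in> kgr_verts r l m"
      "(a, c) \<in> kgr_verts r l m" "(b, c) \<in> kgr_verts r l m"
      using h v by (auto simp: horizontal_iff vertical_iff mem_kgr_verts_iff)
    then have "k < c" "c < j" "min a b < i" "i < max a b"
      using no ends by (auto simp: le_less min_def max_def split: if_splits)
    then show False
      using profile_gap_inside_horizontal[OF h] profile_inside_vertical(1)[OF v] by blast
  qed
  have kj: "k \<le> j"
    using h by (simp add: horizontal_iff)
  have "(i, c) \<in> {(i, j), (i, k)}"
    by (rule vertex_on_arc[OF _ vert])
      (use h ends kj in \<open>auto simp: parcs_kgr_graph mem_segment_horizontal\<close>)
  moreover have "(i, c) \<in> {(a, c), (b, c)}"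
    by (rule vertex_on_arc[OF _ vert])
      (use v ends in \<open>auto simp: parcs_kgr_graph mem_segment_vertical\<close>)
  ultimately show ?thesis
    by blast
qed

lemma horizontal_horizontal_disjoint:
  assumes "((i, j), (i, k)) \<in> kgr_horizontal r l m" "((i, j'), (i, k')) \<in> kgr_horizontal r l m"
    and "j < j'"
  shows "j < k'"
  using assms unfolding horizontal_iff by (cases j k' rule: linorder_cases) auto

text \<open>Neither 1 can lie strictly between the other one and the common -1.\<close>

lemma vertical_vertical_opposite:
  assumes "((i, c), (k, c)) \<in> kgr_vertical r l m" "((i', c), (k, c)) \<in> kgr_vertical r l m"
    and "i < i'"
  shows "i < k \<and> k < i'"
proof -
  have "i \<noteq> k" "i' \<noteq> k" "star i c \<noteq> 0" "star i' c \<noteq> 0"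
    using assms by (auto simp: vertical_iff)
  moreover from this have "\<not> (min i k < i' \<and> i' < max i k)" "\<not> (min i' k < i \<and> i < max i' k)"
    using star_inside_vertical[OF assms(1), of i'] star_inside_vertical[OF assms(2), of i] by blast+
  ultimately show ?thesis
    using assms(3) by arith
qed

lemma arcs_meet_in_common_ends:
  assumes uv: "(u, v) \<in> parcs (kgr_graph r l m)" and xy: "(x, y) \<in> parcs (kgr_graph r l m)"
    and neq: "(u, v) \<noteq> (x, y)"
    and p: "p \<in> closed_segment (matrix_position u) (matrix_position v)"
      "p \<in> closed_segment (matrix_position x) (matrix_position y)"
  shows "p \<in> matrix_position ` ({u, v} \<inter> {x, y})"
proof -
  have hv: "p \<in> matrix_position ` ({(i, j), (i, k)} \<inter> {(a, c), (b, c)})"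
    if "((i, j), (i, k)) \<in> kgr_horizontal r l m" "((a, c), (b, c)) \<in> kgr_vertical r l m"
      and "p \<in> closed_segment (matrix_position (i, j)) (matrix_position (i, k))"
      and "p \<in> closed_segment (matrix_position (a, c)) (matrix_position (b, c))"
    for i j k a b c
  proof -
    have "k \<le> j"
      using that(1) by (simp add: horizontal_iff)
    then have p_eq: "p = matrix_position (i, c)" and "k \<le> c" "c \<le> j" "min a b \<le> i" "i \<le> max a b"
      using that(3,4)
      by (auto simp: mem_segment_horizontal mem_segment_vertical intro!: matrix_position_eqI)
    then show ?thesis
      using horizontal_vertical_meet[OF that(1,2)] by blast
  qed
  from uv show ?thesis
  proof (cases rule: kgr_arc_cases)
    case h: (horizontal i j k)
    from xy show ?thesis
    proof (cases rule: kgr_arc_cases)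
      case h': (horizontal i' j' k')
      have "k < j" "k' < j'"
        using h h' by (auto simp: horizontal_iff)
      then have "i' = i" and meet: "real k \<le> real j'" "real k' \<le> real j"
        using p h h' by (auto simp: mem_segment_horizontal)
      have "j = j'"
        using horizontal_horizontal_disjoint[of i j k j' k'] horizontal_horizontal_disjoint[of i j' k' j k]
          h h' \<open>i' = i\<close> meet by (cases j j' rule: linorder_cases) auto
      then show ?thesis
        using neq h h' \<open>i' = i\<close> horizontal_unique_target by blast
    next
      case v: (vertical a b c)
      show ?thesis
        using hv[OF h(3) v(3)] p h v by simp
    qed
  next
    case v: (vertical a b c)
    from xy show ?thesis
    proof (cases rule: kgr_arc_cases)
      case h: (horizontal i j k)
      show ?thesis
        using hv[OF h(3) v(3)] p h v by (simp add: Int_commute)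
    next
      case v': (vertical a' b' c')
      have "c' = c"
        using p v v' by (auto simp: mem_segment_vertical)
      \<comment> \<open>Vertical arcs in one column share its unique -1, so their tails differ and
        lie on opposite sides of it.\<close>
      then have "b' = b"
        using v v' star_m1_unique by (auto simp: vertical_iff)
      then have "a' \<noteq> a"
        using neq v v' \<open>c' = c\<close> by auto
      then have "p = matrix_position (b, c)"
        using vertical_vertical_opposite[of a c b a'] vertical_vertical_opposite[of a' c b a]
          p v v' \<open>c' = c\<close> \<open>b' = b\<close>
        by (cases a a' rule: linorder_cases)
          (auto simp: mem_segment_vertical intro!: matrix_position_eqI)
      then show ?thesis
        using v v' \<open>c' = c\<close> \<open>b' = b\<close> by simp
    qed
  qed
qed

lemma plane_kgr_graph: "straight_line_plane matrix_position (kgr_graph r l m)"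
  unfolding straight_line_plane_def
proof (intro conjI)
  show "inj_on matrix_position (pverts (kgr_graph r l m))"
    by (auto simp: inj_on_def matrix_position_def)
next
  show "\<forall>(u, v)\<in>parcs (kgr_graph r l m). \<forall>w\<in>pverts (kgr_graph r l m).
      matrix_position w \<in> closed_segment (matrix_position u) (matrix_position v) \<longrightarrow> w \<in> {u, v}"
    unfolding pverts_kgr_graph
    by (intro ballI case_prodI2 impI) (metis vertex_on_arc)
next
  show "\<forall>(u, v)\<in>parcs (kgr_graph r l m). \<forall>(x, y)\<in>parcs (kgr_graph r l m). (u, v) \<noteq> (x, y) \<longrightarrow>
      closed_segment (matrix_position u) (matrix_position v) \<inter>
        closed_segment (matrix_position x) (matrix_position y) \<subseteq> matrix_position ` ({u, v} \<inter> {x, y})"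
    by (intro ballI case_prodI2 impI subsetI) (metis IntD1 IntD2 arcs_meet_in_common_ends)
qed

end

section \<open>Decomposing along a set of columns\<close>

context kostka_pair
begin

text \<open>The partition whose diagram consists of the columns of \<open>l\<close> with index in
  \<open>J\<close>.\<close>

definition l_on :: "nat set \<Rightarrow> nat \<Rightarrow> nat" where
  "l_on J i = card {c \<in> J. c < l i}"

definition m_on :: "nat set \<Rightarrow> nat \<Rightarrow> nat" where
  "m_on J i = card {c \<in> J. i \<in> chosen c}"

text \<open>
  The columns in \<open>J\<close> of the canonical matrix witness the dominance (the easy half of Gale-Ryser).
\<close>

lemma restriction_in_Kostka:
  assumes J: "J \<subseteq> {..<l 0}" and nonneg: "\<And>i. 0 \<le> (\<Sum>c\<in>J. star i c)"
  shows "(l_on J, m_on J) \<in> Kostka r"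
proof -
  have fin: "finite J"
    using J finite_subset by blast
  have m_sum: "m_on J i = (\<Sum>c\<in>J. of_bool (i \<in> chosen c))" for i
    using fin by (auto simp: m_on_def intro!: arg_cong[of _ _ card])
  have "partition_le r (l_on J)"
    unfolding partition_le_def
  proof (intro conjI antimonoI allI impI)
    show "l_on J s \<le> l_on J u" if "u \<le> s" for u s
      unfolding l_on_def
      by (rule card_mono)
        (use fin partition_l that in \<open>auto simp: partition_le_def antimono_def intro: less_le_trans\<close>)
    show "l_on J i = 0" if "r \<le> i" for i
      using partition_l that by (simp add: l_on_def partition_le_def)
  qed
  moreover have "partition_le r (m_on J)"
    unfolding partition_le_def
  proof (intro conjI allI impI)
    \<comment> \<open>Consecutive parts of \<open>m_on J\<close> differ by a row sum of the star
      matrix over \<open>J\<close>, so \<open>nonneg\<close> makes it a partition.\<close>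
    have "int (m_on J (Suc i)) \<le> int (m_on J i)" for i
    proof -
      have "int (m_on J i) - int (m_on J (Suc i)) = (\<Sum>c\<in>J. star i c)"
        unfolding m_sum of_nat_sum sum_subtractf[symmetric]
        by (rule sum.cong) (use J in \<open>auto simp: star_eq\<close>)
      then show ?thesis
        using nonneg[of i] by simp
    qed
    then show "antimono (m_on J)"
      by (simp add: decseq_Suc_iff)
    show "m_on J i = 0" if "r \<le> i" for i
    proof -
      have "i \<notin> chosen c" for c
        using chosen_subset[of c] that by auto
      then show ?thesis
        by (simp add: m_on_def)
    qed
  qed
  moreover have m_partial: "(\<Sum>i<t. m_on J i) = (\<Sum>c\<in>J. card ({..<t} \<inter> chosen c))" for t
    unfolding m_sum by (subst sum.swap) simp
  have l_partial: "(\<Sum>i<t. l_on J i) = (\<Sum>c\<in>J. min t (conjugate l c))" for t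
    by (simp add: l_on_def sum_min_conjugate[OF partition_l fin])
  have fin_chosen: "finite (chosen c)" for c
    using chosen_subset finite_subset by blast
  have "(\<Sum>i<r. l_on J i) = (\<Sum>i<r. m_on J i)"
    unfolding m_partial l_partial
    by (rule sum.cong) (auto simp: Int_absorb1 chosen_subset card_chosen min_absorb2 conjugate_le[OF partition_l])
  moreover have "(\<Sum>i<t. m_on J i) \<le> (\<Sum>i<t. l_on J i)" for t
    unfolding m_partial l_partial
  proof (rule sum_mono)
    fix c
    have "card ({..<t} \<inter> chosen c) \<le> card {..<t}" "card ({..<t} \<inter> chosen c) \<le> card (chosen c)"
      by (rule card_mono; use fin_chosen in auto)+
    then show "card ({..<t} \<inter> chosen c) \<le> min t (conjugate l c)"
      by (simp add: card_chosen)
  qed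
  ultimately show ?thesis
    by (simp add: Kostka_def)
qed

lemma not_in_hilbert_basis:
  assumes J: "J \<subseteq> {..<l 0}" "J \<noteq> {}" "J \<noteq> {..<l 0}"
    and nonneg: "\<And>i. 0 \<le> (\<Sum>c\<in>J. star i c)" "\<And>i. 0 \<le> (\<Sum>c\<in>{..<l 0} - J. star i c)"
  shows "(l, m) \<notin> hilbert_basis (Kostka r)"
proof -
  let ?J' = "{..<l 0} - J"
  have fin: "finite J"
    using J finite_subset by blast
  have split: "card {c \<in> J. P c} + card {c \<in> ?J'. P c} = card {c. c < l 0 \<and> P c}" for P
  proof -
    have "{c. c < l 0 \<and> P c} = {c \<in> J. P c} \<union> {c \<in> ?J'. P c}"
      using J(1) by auto
    then show ?thesis
      using fin by (simp, subst card_Un_disjoint) auto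
  qed
  have l: "l i = l_on J i + l_on ?J' i" for i
    using split[of "\<lambda>c. c < l i"] card_columns_below[of i] by (simp add: l_on_def)
  have m: "m i = m_on J i + m_on ?J' i" for i
  proof -
    have "m i = card {c. c < l 0 \<and> i \<in> chosen c}"
      using profile_eq_sum[of "l 0" i]
      by (simp add: profile_initial lessThan_def Collect_conj_eq)
    then show ?thesis
      using split[of "\<lambda>c. i \<in> chosen c"] by (simp add: m_on_def)
  qed
  have "l = l_on J + l_on ?J'" "m = m_on J + m_on ?J'"
    using l m unfolding plus_fun_def by blast+
  then have sum: "(l, m) = (l_on J, m_on J) + (l_on ?J', m_on ?J')"
    unfolding plus_prod_def fst_conv snd_conv by (rule arg_cong2[of _ _ _ _ Pair])
  \<comment> \<open>Every column below \<open>l 0\<close> of the diagram of \<open>l\<close> has a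
    cell in row 0, so the first part of \<open>l_on K\<close> is \<open>card K\<close>.\<close>
  have nonzero: "(l_on K, m_on K) \<noteq> 0" if "K \<subseteq> {..<l 0}" "K \<noteq> {}" for K
  proof -
    have "{c \<in> K. c < l 0} = K" "finite K"
      using that finite_subset by auto
    then have "l_on K 0 \<noteq> 0"
      using that by (simp add: l_on_def)
    then show ?thesis
      by (auto simp: prod_eq_iff fun_eq_iff)
  qed
  have "(l_on J, m_on J) \<in> Kostka r" "(l_on ?J', m_on ?J') \<in> Kostka r"
    using restriction_in_Kostka J nonneg by auto
  moreover have "(l_on J, m_on J) \<noteq> 0" "(l_on ?J', m_on ?J') \<noteq> 0"
    by (rule nonzero; use J in blast)+
  ultimately show ?thesis
    using sum unfolding hilbert_basis_def by blast
qed

text \<open>Within \<open>J\<close>, the map \<open>f\<close> injects the -1s of row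
  \<open>i\<close> into its 1s.\<close>

lemma sum_star_nonneg:
  assumes J: "J \<subseteq> {..<l 0}"
    and f: "inj_on f {c \<in> J. star i c = -1}" "\<And>c. c \<in> J \<Longrightarrow> star i c = -1 \<Longrightarrow> f c \<in> J \<and> star i (f c) = 1"
  shows "0 \<le> (\<Sum>c\<in>J. star i c)"
proof -
  have fin: "finite J"
    using J finite_subset by blast
  have "star i c = of_bool (star i c = 1) - of_bool (star i c = -1)" if "c \<in> J" for c
    using star_cases[of c i] that J by (cases "star i c = 0") auto
  then have "(\<Sum>c\<in>J. star i c) = (\<Sum>c\<in>J. of_bool (star i c = 1) - of_bool (star i c = -1))"
    by (rule sum.cong[OF refl])
  also have "\<dots> = int (card {c \<in> J. star i c = 1}) - int (card {c \<in> J. star i c = -1})"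
    using fin by (simp add: sum_subtractf Collect_conj_eq)
  finally show ?thesis
    using card_inj_on_le[OF f(1), of "{c \<in> J. star i c = 1}"] f(2) fin by auto
qed

text \<open>The value is meaningful only at a -1, where \<open>horizontal_exists\<close> provides
  the arc.\<close>

definition partner :: "nat \<Rightarrow> nat \<Rightarrow> nat" where
  "partner i j = (SOME k. ((i, j), (i, k)) \<in> kgr_horizontal r l m)"

lemma partner_arc:
  assumes "j < l 0" "star i j = -1"
  shows "((i, j), (i, partner i j)) \<in> kgr_horizontal r l m"
  unfolding partner_def using horizontal_exists[OF assms] by (metis someI_ex)

lemma inj_on_partner: "inj_on (partner i) {c. c < l 0 \<and> star i c = -1}"
proof (rule inj_onI)
  fix x y
  assume "x \<in> {c. c < l 0 \<and> star i c = -1}" "y \<in> {c. c < l 0 \<and> star i c = -1}"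
    and "partner i x = partner i y"
  then show "x = y"
    using partner_arc[of x i] partner_arc[of y i] horizontal_unique_source by fastforce
qed

end

section \<open>Conservative subtrees\<close>

context kostka_pair
begin

lemma partner_star:
  assumes "j < l 0" "star i j = -1"
  shows "partner i j < j" "star i (partner i j) = 1"
  using partner_arc[OF assms] by (auto simp: horizontal_iff)

text \<open>A component contains all vertices of each column it meets and no arc leaves it. So each
  -1 and its partner lie on the same side of the split, and \<open>partner\<close> is a suitable
  injection on both sides.\<close>

lemma component_not_in_hilbert_basis:
  assumes comp: "connected_component_of H (kgr_graph r l m)"
    and ne: "pverts H \<noteq> {}" "H \<noteq> kgr_graph r l m"
  shows "(l, m) \<notin> hilbert_basis (Kostka r)"
proof -
  let ?J = "snd ` pverts H"
  have sub: "pverts H \<subseteq> kgr_verts r l m"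
    using comp by (auto simp: connected_component_of_def pre_digraph.max_subgraph_def subgraph_def
        pverts_kgr_graph)
  have arc: "u \<in> pverts H \<longleftrightarrow> v \<in> pverts H" if "(u, v) \<in> kgr_horizontal r l m \<union> kgr_vertical r l m" for u v
    using component_arc_closed[OF comp] that by (simp add: parcs_kgr_graph)
  \<comment> \<open>All 1s of a column are joined to its unique -1; a column without a -1 has at
    most one vertex, since two 1s force a -1.\<close>
  have column: "(i, c) \<in> pverts H" if i: "(i, c) \<in> kgr_verts r l m" and c: "c \<in> ?J" for i c
  proof -
    obtain x where x: "(x, c) \<in> pverts H"
      using c by auto
    have x': "(x, c) \<in> kgr_verts r l m"
      using x sub by auto
    have c': "c < l 0"
      using i by (simp add: mem_kgr_verts_iff)
    show ?thesis
    proof (cases "\<exists>y. star y c = -1")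
      case True
      then obtain y where y: "star y c = -1"
        by blast
      have "(z, c) \<in> pverts H \<longleftrightarrow> (y, c) \<in> pverts H" if "(z, c) \<in> kgr_verts r l m" for z
      proof (cases "star z c = -1")
        case True
        then show ?thesis
          using star_m1_unique[OF c' y] by simp
      next
        case False
        then have "star z c = 1"
          using that star_cases[OF c'] by (auto simp: mem_kgr_verts_iff)
        then show ?thesis
          using arc[of "(z, c)" "(y, c)"] y c' by (simp add: vertical_iff)
      qed
      then show ?thesis
        using i x x' by blast
    next
      case False
      then have "star x c = 1" "star i c = 1"
        using i x' star_cases[OF c'] by (auto simp: mem_kgr_verts_iff)
      then have "x = i"
        using False column_has_m1_of_two_1s[OF c'] by (metis linorder_neqE_nat)
      with x show ?thesis
        by simp
    qed
  qed
  show ?thesis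
  proof (rule not_in_hilbert_basis)
    show J: "?J \<subseteq> {..<l 0}"
      using sub by (auto simp: mem_kgr_verts_iff)
    show "?J \<noteq> {}"
      using ne(1) by simp
    have "pverts H \<noteq> kgr_verts r l m"
      using component_spanning[OF comp] ne(2) by (auto simp: pverts_kgr_graph)
    then obtain i c where "(i, c) \<in> kgr_verts r l m" "(i, c) \<notin> pverts H"
      using sub by auto
    then show "?J \<noteq> {..<l 0}"
      using column[of i c] by (auto simp: mem_kgr_verts_iff)
    fix i
    have iff: "c \<in> ?J \<longleftrightarrow> partner i c \<in> ?J" if "c < l 0" "star i c = -1" for c
    proof -
      have "(i, c) \<in> kgr_verts r l m" "(i, partner i c) \<in> kgr_verts r l m"
        using that partner_star[OF that] by (auto simp: mem_kgr_verts_iff)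
      moreover have "(i, c) \<in> pverts H \<longleftrightarrow> (i, partner i c) \<in> pverts H"
        using arc partner_arc[OF that] by blast
      ultimately show ?thesis
        using column by (metis image_eqI snd_conv)
    qed
    show "0 \<le> (\<Sum>c\<in>?J. star i c)"
    proof (rule sum_star_nonneg[OF J, of "partner i"])
      show "inj_on (partner i) {c \<in> ?J. star i c = -1}"
        using J by (intro inj_on_subset[OF inj_on_partner]) auto
      show "partner i c \<in> ?J \<and> star i (partner i c) = 1" if "c \<in> ?J" "star i c = -1" for c
        using iff[of c] partner_star[of c i] that J by blast
    qed
    show "0 \<le> (\<Sum>c\<in>{..<l 0} - ?J. star i c)"
    proof (rule sum_star_nonneg[of _ "partner i"])
      show "inj_on (partner i) {c \<in> {..<l 0} - ?J. star i c = -1}"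
        by (intro inj_on_subset[OF inj_on_partner]) auto
      show "partner i c \<in> {..<l 0} - ?J \<and> star i (partner i c) = 1"
        if "c \<in> {..<l 0} - ?J" "star i c = -1" for c
        using iff[of c] partner_star[of c i] that by auto
    qed simp
  qed
qed

text \<open>
  The sink \<open>(i, j)\<close> loses its partner, but the source \<open>(i, k)\<close> takes its place; on the
  complementary columns, the former partner of the sink replaces \<open>(i, k)\<close>.
\<close>

lemma sink_not_in_hilbert_basis:
  assumes sub: "subgraph (with_proj H) (with_proj (kgr_graph r l m))"
    and cols: "\<And>x c y x' y'. ((x, c), (y, c)) \<in> parcs H \<inter> kgr_vertical r l m \<Longrightarrow>
      ((x', c), (y', c)) \<in> kgr_vertical r l m \<Longrightarrow> ((x', c), (y', c)) \<in> parcs H"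
    and sinks: "graph_sinks H = {(i, j)}" and sink: "star i j = -1"
    and source: "(i, k) \<in> graph_sources H" "star i k = 1"
    and sources: "graph_sources H - {(i, k)} \<subseteq> graph_sources (kgr_graph r l m)"
  shows "(l, m) \<notin> hilbert_basis (Kostka r)"
proof -
  let ?J = "snd ` pverts H"
  have verts: "pverts H \<subseteq> kgr_verts r l m"
    and arcs: "parcs H \<subseteq> parcs (kgr_graph r l m)" and wf: "wf_digraph (with_proj H)"
    using sub by (auto simp: subgraph_def pverts_kgr_graph)
  have J: "?J \<subseteq> {..<l 0}"
    using verts by (auto simp: mem_kgr_verts_iff)
  have ij: "(i, j) \<in> pverts H" and ik: "(i, k) \<in> pverts H"
    using sinks source(1) mem_graph_sinks_iff[of "(i, j)" H] mem_graph_sources_iff[of "(i, k)" H] by auto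
  have j: "j < l 0" and k: "k < l 0"
    using ij ik verts by (auto simp: mem_kgr_verts_iff)
  have out: "\<exists>w. (v, w) \<in> parcs H" if "v \<in> pverts H" "v \<noteq> (i, j)" for v
  proof -
    have "v \<notin> graph_sinks H"
      using sinks that(2) by simp
    then show ?thesis
      using that(1) mem_graph_sinks_iff[of v H] by blast
  qed
  have into: "\<exists>u. (u, v) \<in> parcs H"
    if "v \<in> pverts H" "v \<noteq> (i, k)" "(u, v) \<in> parcs (kgr_graph r l m)" for u v
  proof -
    have "v \<notin> graph_sources (kgr_graph r l m)"
      using that(3) mem_graph_sources_iff[of v] by blast
    then have "v \<notin> graph_sources H"
      using sources that(2) by auto
    then show ?thesis
      using that(1) mem_graph_sources_iff[of v H] by blast
  qed
  have no_into_k: "(u, (i, k)) \<notin> parcs H" for u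
    using source(1) mem_graph_sources_iff[of "(i, k)" H] by blast
  \<comment> \<open>Out-arcs never lead to a larger column, and following them inside
    \<open>H\<close> ends at the only sink \<open>(i, j)\<close>.\<close>
  have column_ge: "j \<le> snd v" if "v \<in> pverts H" for v
    using that
  proof (induction "rank v" arbitrary: v rule: less_induct)
    case less
    show ?case
    proof (cases "v = (i, j)")
      case False
      then obtain w where w: "(v, w) \<in> parcs H"
        using out less.prems by blast
      then have vw: "(v, w) \<in> parcs (kgr_graph r l m)"
        using arcs by blast
      have "j \<le> snd w"
        using less.hyps[OF rank_decreasing[OF vw]] wf_with_projD(2)[OF wf w] by blast
      also have "snd w \<le> snd v"
        using vw by (cases rule: kgr_arc_cases) (auto simp: horizontal_iff)
      finally show ?thesis .
    qed simp
  qed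
  have jk: "j < k"
    using column_ge[OF ik] sink source(2) by (cases "j = k") auto
  have column: "(x, c) \<in> pverts H" if x: "(x, c) \<in> kgr_verts r l m" and c: "c \<in> ?J" for x c
  proof -
    obtain y where y: "(y, c) \<in> pverts H"
      using c by auto
    have c': "c < l 0"
      using c J by auto
    \<comment> \<open>A -1 in \<open>H\<close> is not the exceptional source and has an incoming
      vertical arc in the whole graph, hence also one in \<open>H\<close>. A 1 in \<open>H\<close>
      is not the sink, so it has an outgoing one. Then \<open>cols\<close> brings in the rest of the
      column.\<close>
    have "\<exists>a b. ((a, c), (b, c)) \<in> parcs H \<inter> kgr_vertical r l m"
    proof (cases "star y c = -1")
      case True
      obtain z where z: "star z c = 1"
        using column_has_1_of_m1[OF c' True] by blast
      have "((z, c), (y, c)) \<in> parcs (kgr_graph r l m)"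
        using z True c' by (simp add: parcs_kgr_graph vertical_iff)
      moreover have "(y, c) \<noteq> (i, k)"
        using True source(2) by auto
      ultimately obtain u where u: "(u, (y, c)) \<in> parcs H"
        using into y by blast
      then have "(u, (y, c)) \<in> parcs (kgr_graph r l m)"
        using arcs by blast
      then show ?thesis
        using u True by (cases rule: kgr_arc_cases) (auto simp: horizontal_iff)
    next
      case False
      then obtain w where w: "((y, c), w) \<in> parcs H"
        using out[OF y] sink by auto
      then have "((y, c), w) \<in> parcs (kgr_graph r l m)"
        using arcs by blast
      then show ?thesis
        using w False by (cases rule: kgr_arc_cases) (auto simp: horizontal_iff)
    qed
    then obtain a b where ab: "((a, c), (b, c)) \<in> parcs H \<inter> kgr_vertical r l m"
      by blast
    then have signs: "star a c = 1" "star b c = -1"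
      by (auto simp: vertical_iff)
    have "star x c = 1 \<or> star x c = -1"
      using x star_cases[OF c'] by (simp add: mem_kgr_verts_iff)
    then show ?thesis
    proof
      assume "star x c = 1"
      then have "((x, c), (b, c)) \<in> parcs H"
        using cols[OF ab] signs c' by (simp add: vertical_iff)
      then show ?thesis
        by (rule wf_with_projD(1)[OF wf])
    next
      assume "star x c = -1"
      then have "((a, c), (x, c)) \<in> parcs H"
        using cols[OF ab] signs c' by (simp add: vertical_iff)
      then show ?thesis
        by (rule wf_with_projD(2)[OF wf])
    qed
  qed
  have J_iff: "c \<in> ?J \<longleftrightarrow> (x, c) \<in> pverts H" if "c < l 0" "star x c \<noteq> 0" for x c
    using column[of x c] that by (force simp: mem_kgr_verts_iff)
  have partner_arc_H: "((x, c), (x, partner x c)) \<in> parcs H"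
    if "c \<in> ?J" "star x c = -1" and neq: "(x, c) \<noteq> (i, j)" for x c
  proof -
    have c: "c < l 0"
      using that J by auto
    then have "(x, c) \<in> pverts H"
      using J_iff[of c x] that by simp
    then obtain w where w: "((x, c), w) \<in> parcs H"
      using out neq by blast
    have "((x, c), (x, partner x c)) \<in> parcs (kgr_graph r l m)"
      using partner_arc[OF c that(2)] by (simp add: parcs_kgr_graph)
    then show ?thesis
      using kgr_out_unique w arcs by blast
  qed
  have partner_in: "partner x c \<in> ?J" if "c \<in> ?J" "star x c = -1" "(x, c) \<noteq> (i, j)" for x c
    using wf_with_projD(2)[OF wf partner_arc_H[OF that]] by (metis image_eqI snd_conv)
  \<comment> \<open>Apart from \<open>(i, k)\<close>, a vertex of \<open>H\<close> with an incoming
    arc in the whole graph has one in \<open>H\<close>. A 1 receives at most one arc, so here it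
    comes from \<open>(x, c)\<close>.\<close>
  have partner_back: "c \<in> ?J"
    if "partner x c \<in> ?J" "c < l 0" "star x c = -1" and neq: "(x, partner x c) \<noteq> (i, k)" for x c
  proof -
    have p: "partner x c < l 0" "star x (partner x c) = 1"
      using partner_star[OF that(2,3)] that(2) by auto
    then have "(x, partner x c) \<in> pverts H"
      using J_iff[of "partner x c" x] that(1) by simp
    moreover have "((x, c), (x, partner x c)) \<in> parcs (kgr_graph r l m)"
      using partner_arc[OF that(2,3)] by (simp add: parcs_kgr_graph)
    ultimately obtain u where u: "(u, (x, partner x c)) \<in> parcs H"
      using into neq by blast
    then have "(u, (x, partner x c)) \<in> parcs (kgr_graph r l m)"
      using arcs by blast
    then have "u = (x, c)"
    proof (cases rule: kgr_arc_cases)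
      case (horizontal a b d)
      then show ?thesis
        using horizontal_unique_source partner_arc[OF that(2,3)] by blast
    qed (use p in \<open>auto simp: vertical_iff\<close>)
    then show ?thesis
      using wf_with_projD(1)[OF wf u] by force
  qed
  \<comment> \<open>The partner of the sink lies left of column \<open>j\<close>, where
    \<open>H\<close> has no vertices.\<close>
  have sink_partner: "partner i j < l 0" "partner i j \<notin> ?J"
    using partner_star[OF j sink] j column_ge by force+
  show ?thesis
  proof (rule not_in_hilbert_basis[OF J])
    show "?J \<noteq> {}"
      using ij by auto
    show "?J \<noteq> {..<l 0}"
      using sink_partner by blast
    fix x
    define f where "f = (if x = i then (partner i)(j := k) else partner x)"
    show "0 \<le> (\<Sum>c\<in>?J. star x c)"
    proof (rule sum_star_nonneg[OF J, of f])
      have inj: "inj_on (partner x) {c \<in> ?J. star x c = -1}"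
        using J by (intro inj_on_subset[OF inj_on_partner]) auto
      \<comment> \<open>An arc from \<open>(i, c)\<close> with \<open>c\<close> other than
        \<open>j\<close> would enter the source \<open>(i, k)\<close> within \<open>H\<close>, and
        the partner of \<open>j\<close> lies left of \<open>j < k\<close>. So redirecting
        \<open>j\<close> to \<open>k\<close> keeps injectivity.\<close>
      have "partner i c \<noteq> k" if "c \<in> ?J" "star i c = -1" for c
      proof (cases "c = j")
        case True
        then show ?thesis
          using partner_star(1)[OF j sink] jk by simp
      next
        case False
        then show ?thesis
          using partner_arc_H[OF that] no_into_k by auto
      qed
      then have "k \<notin> partner i ` {c \<in> ?J. star i c = -1}"
        by blast
      then show "inj_on f {c \<in> ?J. star x c = -1}"
        using inj by (auto simp: f_def intro: inj_on_fun_updI)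
      show "f c \<in> ?J \<and> star x (f c) = 1" if "c \<in> ?J" "star x c = -1" for c
      proof (cases "(x, c) = (i, j)")
        case True
        then show ?thesis
          using ik source(2) by (force simp: f_def)
      next
        case False
        then have "f c = partner x c"
          by (auto simp: f_def)
        then show ?thesis
          using partner_in[OF that False] partner_star[of c x] that J by auto
      qed
    qed
    define g where "g c = (if x = i \<and> partner i c = k then partner i j else partner x c)" for c
    show "0 \<le> (\<Sum>c\<in>{..<l 0} - ?J. star x c)"
    proof (rule sum_star_nonneg[of _ g])
      \<comment> \<open>Partners are distinct and \<open>j\<close> lies in \<open>?J\<close>, so the
        value \<open>partner i j\<close> is free on the complement.\<close>
      have "partner i c \<noteq> partner i j" if "c < l 0" "c \<notin> ?J" "star i c = -1" for c
        using inj_onD[OF inj_on_partner, of i c j] that j sink ij by force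
      then show "inj_on g {c \<in> {..<l 0} - ?J. star x c = -1}"
        using inj_on_partner[of x] by (auto simp: g_def inj_on_def) blast
      show "g c \<in> {..<l 0} - ?J \<and> star x (g c) = 1"
        if c: "c \<in> {..<l 0} - ?J" "star x c = -1" for c
      proof (cases "x = i \<and> partner i c = k")
        case True
        then show ?thesis
          using sink_partner partner_star[OF j sink] by (simp add: g_def)
      next
        case False
        then have "g c = partner x c"
          by (auto simp: g_def)
        then show ?thesis
          using partner_back[of x c] partner_star[of c x] c False by auto
      qed
    qed simp
  qed
qed

lemma conservative_subtree_not_in_hilbert_basis:
  assumes "conservative_subtree r l m H"
  shows "(l, m) \<notin> hilbert_basis (Kostka r)"
proof (cases "connected_component_of H (kgr_graph r l m)")
  case True
  then show ?thesis
    using component_not_in_hilbert_basis assms by (simp add: conservative_subtree_def)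
next
  case False
  then obtain i j k where "graph_sinks H = {(i, j)}" "star i j = -1"
    "(i, k) \<in> graph_sources H" "star i k = 1"
    "graph_sources H - {(i, k)} \<subseteq> graph_sources (kgr_graph r l m)"
    using assms by (auto simp: conservative_subtree_def)
  then show ?thesis
    by (rule sink_not_in_hilbert_basis[rotated 2])
      (use assms in \<open>unfold conservative_subtree_def, blast\<close>)+
qed

end

theorem theorem2p8:
  fixes r :: nat and l m :: "nat \<Rightarrow> nat"
  assumes "r \<ge> 1" and "(l, m) \<in> Kostka r"
  shows "undirected_forest (kgr_graph r l m) \<and>
    straight_line_plane matrix_position (kgr_graph r l m) \<and>
    (\<forall>H. conservative_subtree r l m H \<longrightarrow> undirected_tree H) \<and>
    ((\<exists>H. conservative_subtree r l m H) \<longrightarrow> (l, m) \<notin> hilbert_basis (Kostka r))"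
proof -
  interpret kostka_pair r l m
    using assms(2) by unfold_locales
  have "undirected_tree H" if "conservative_subtree r l m H" for H
    using that undirected_forest_subgraph[of H]
    by (auto simp: conservative_subtree_def undirected_tree_def subgraph_def)
  then show ?thesis
    using undirected_forest_subgraph[of "kgr_graph r l m"] plane_kgr_graph
      conservative_subtree_not_in_hilbert_basis by blast
qed

end
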